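(* Let $H$ and $\tilde H$ be Hilbert spaces, let $U,V$ be unitary operators on $H$ and let $\tilde U,\tilde V$ be unitary operators on $\tilde H$. Let $S_{U,V}$ and $S_{\tilde U,\tilde V}$ be the associated systems of five subspaces of $H\oplus H$ and $\tilde H\oplus\tilde H$ respectively (defined in the context). Then the system $S_{U,V}$ is transitive if and only if the pair of unitary operators $U,V$ is irreducible. Moreover, $S_{U,V}\cong S_{\tilde U,\tilde V}$ if and only if the pair $U,V$ is unitarily equivalent to the pair $\tilde U,\tilde V$.
   Context: Hilbert spaces are complex and nonzero; $B(H,\tilde H)$ denotes bounded linear operators and $B(H)=B(H,H)$. A system of $n$ subspaces $S=(H;H_1,\dots,H_n)$ consists of a Hilbert space $H$ and $n$ (closed) subspaces $H_1,\dots,H_n$ of $H$. Systems $S=(H;H_1,\dots,H_n)$ and $\tilde S=(\tilde H;\tilde H_1,\dots,\tilde H_n)$ are isomorphic, $S\cong\tilde S$, if there is a bounded linear bijection $R:H\to\tilde H$ with $R(H_i)=\tilde H_i$ for all $i=1,\dots,n$. Put $\mathrm{End}(S)=\{R\in B(H) : R(H_i)\subset H_i,\ i=1,\dots,n\}$; the system $S$ is called transitive if $\mathrm{End}(S)=\mathbb C I_H$. For unitary operators $U,V$ on $H$, let $\mathcal H=H\oplus H$ and let $$P_1=\begin{pmatrix} I & 0 \\ 0 & 0 \end{pmatrix},\ P_2=\begin{pmatrix} 0 & 0 \\ 0 & I \end{pmatrix},\ P_3=\tfrac12\begin{pmatrix} I & I \\ I & I \end{pmatrix},\ P_4=\tfrac12\begin{pmatrix}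 I & U \\ U^* & I \end{pmatrix},\ P_5=\tfrac12\begin{pmatrix} I & V \\ V^* & I \end{pmatrix},$$ which are orthogonal projections on $\mathcal H$. Then $S_{U,V}=(\mathcal H;P_1\mathcal H,P_2\mathcal H,P_3\mathcal H,P_4\mathcal H,P_5\mathcal H)$. The system $S_{\tilde U,\tilde V}$ is defined in the same way from $\tilde U,\tilde V$ on $\tilde H\oplus\tilde H$. A pair of unitary operators $U,V$ on $H$ is irreducible if the only closed subspaces of $H$ invariant under $U,V,U^*,V^*$ are $\{0\}$ and $H$. Pairs $U,V$ on $H$ and $\tilde U,\tilde V$ on $\tilde H$ are unitarily equivalent if there is a unitary $W:H\to\tilde H$ with $WU=\tilde UW$ and $WV=\tilde VW$. *)

theory Defs
  imports "HOL-Analysis.Analysis"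
begin

text \<open>The norm, metric and topology are those of the underlying real Hilbert space, whose
  inner product is the real part of the complex one. The complex inner product is linear
  in its first argument. The zero space is not excluded by the class.\<close>

class chilbert_space = real_inner + complete_space +
  fixes scaleC :: "complex \<Rightarrow> 'a \<Rightarrow> 'a" (infixr "*\<^sub>C" 75)
    and cinner :: "'a \<Rightarrow> 'a \<Rightarrow> complex"
  assumes scaleC_add_right: "a *\<^sub>C (x + y) = a *\<^sub>C x + a *\<^sub>C y"
    and scaleC_add_left: "(a + b) *\<^sub>C x = a *\<^sub>C x + b *\<^sub>C x"
    and scaleC_scaleC: "a *\<^sub>C (b *\<^sub>C x) = (a * b) *\<^sub>C x"
    and scaleR_scaleC: "scaleR r x = complex_of_real r *\<^sub>C x"
    and cinner_commute: "cinner x y = cnj (cinner y x)"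
    and cinner_add_left: "cinner (x + y) z = cinner x z + cinner y z"
    and cinner_scaleC_left: "cinner (a *\<^sub>C x) y = a * cinner x y"
    and inner_Re_cinner: "inner x y = Re (cinner x y)"

text \<open>The orthogonal direct sum of two Hilbert spaces is their product type.\<close>

instantiation prod :: (chilbert_space, chilbert_space) chilbert_space
begin

definition scaleC_prod :: "complex \<Rightarrow> 'a \<times> 'b \<Rightarrow> 'a \<times> 'b" where
  "scaleC_prod c p = (c *\<^sub>C fst p, c *\<^sub>C snd p)"

definition cinner_prod :: "'a \<times> 'b \<Rightarrow> 'a \<times> 'b \<Rightarrow> complex" where
  "cinner_prod p q = cinner (fst p) (fst q) + cinner (snd p) (snd q)"

instance
proof
  fix a b :: complex and r :: real and x y z :: "'a \<times> 'b"
  show "a *\<^sub>C (x + y) = a *\<^sub>C x + a *\<^sub>C y"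
    by (simp add: scaleC_prod_def scaleC_add_right)
  show "(a + b) *\<^sub>C x = a *\<^sub>C x + b *\<^sub>C x"
    by (simp add: scaleC_prod_def scaleC_add_left)
  show "a *\<^sub>C (b *\<^sub>C x) = (a * b) *\<^sub>C x"
    by (simp add: scaleC_prod_def scaleC_scaleC)
  show "scaleR r x = complex_of_real r *\<^sub>C x"
    by (simp add: scaleC_prod_def scaleR_prod_def scaleR_scaleC)
  show "cinner x y = cnj (cinner y x)"
    unfolding cinner_prod_def
    by (subst cinner_commute, subst cinner_commute[of "snd x"]) simp
  show "cinner (x + y) z = cinner x z + cinner y z"
    by (simp add: cinner_prod_def cinner_add_left)
  show "cinner (a *\<^sub>C x) y = a * cinner x y"
    by (simp add: cinner_prod_def scaleC_prod_def cinner_scaleC_left distrib_left)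
  show "inner x y = Re (cinner x y)"
    by (simp add: cinner_prod_def inner_prod_def inner_Re_cinner)
qed

end

definition bounded_clinear :: "('a::chilbert_space \<Rightarrow> 'b::chilbert_space) \<Rightarrow> bool" where
  "bounded_clinear f \<longleftrightarrow> bounded_linear f \<and> (\<forall>c x. f (c *\<^sub>C x) = c *\<^sub>C f x)"

text \<open>Meaningful for bounded complex-linear operators; see \<open>cadjoint_works\<close> and
  \<open>cadjoint_unique\<close> below.\<close>

definition cadjoint :: "('a::chilbert_space \<Rightarrow> 'b::chilbert_space) \<Rightarrow> 'b \<Rightarrow> 'a" where
  "cadjoint A = (SOME B. \<forall>x y. cinner (A x) y = cinner x (B y))"

definition unitary :: "('a::chilbert_space \<Rightarrow> 'b::chilbert_space) \<Rightarrow> bool" where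
  "unitary U \<longleftrightarrow> bounded_clinear U \<and> cadjoint U \<circ> U = id \<and> U \<circ> cadjoint U = id"

definition orthogonal_projection :: "('a::chilbert_space \<Rightarrow> 'a) \<Rightarrow> bool" where
  "orthogonal_projection P \<longleftrightarrow> bounded_clinear P \<and> P \<circ> P = P \<and> cadjoint P = P"

definition closed_csubspace :: "'a::chilbert_space set \<Rightarrow> bool" where
  "closed_csubspace M \<longleftrightarrow> 0 \<in> M \<and> (\<forall>x\<in>M. \<forall>y\<in>M. x + y \<in> M) \<and> (\<forall>c. \<forall>x\<in>M. c *\<^sub>C x \<in> M)
     \<and> closed M"

text \<open>A system \<open>(H; H_1, ..., H_n)\<close> is the list \<open>[H_1, ..., H_n]\<close>; the ambient space \<open>H\<close> is
  the underlying type.\<close>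

definition subspace_system :: "nat \<Rightarrow> 'a::chilbert_space set list \<Rightarrow> bool" where
  "subspace_system n S \<longleftrightarrow> length S = n \<and> (\<forall>i<n. closed_csubspace (S ! i))"

definition isomorphic_systems ::
    "'a::chilbert_space set list \<Rightarrow> 'b::chilbert_space set list \<Rightarrow> bool" where
  "isomorphic_systems S T \<longleftrightarrow> length S = length T \<and>
     (\<exists>R. bounded_clinear R \<and> bij R \<and> (\<forall>i<length S. R ` (S ! i) = T ! i))"

definition End_system :: "'a::chilbert_space set list \<Rightarrow> ('a \<Rightarrow> 'a) set" where
  "End_system S = {R. bounded_clinear R \<and> (\<forall>i<length S. R ` (S ! i) \<subseteq> S ! i)}"

definition transitive_system :: "'a::chilbert_space set list \<Rightarrow> bool" where
  "transitive_system S \<longleftrightarrow> End_system S = range (\<lambda>(c::complex) x. c *\<^sub>C x)"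

text \<open>The operator on \<open>H \<oplus> H\<close> with block rows \<open>(A, B)\<close> and \<open>(C, D)\<close>.\<close>

definition block_op ::
    "('a \<Rightarrow> 'a) \<Rightarrow> ('a \<Rightarrow> 'a) \<Rightarrow> ('a \<Rightarrow> 'a) \<Rightarrow> ('a \<Rightarrow> 'a) \<Rightarrow>
     'a::chilbert_space \<times> 'a \<Rightarrow> 'a \<times> 'a" where
  "block_op A B C D = (\<lambda>(x, y). (A x + B y, C x + D y))"

definition proj1 :: "'a::chilbert_space \<times> 'a \<Rightarrow> 'a \<times> 'a" where
  "proj1 = block_op id (\<lambda>_. 0) (\<lambda>_. 0) (\<lambda>_. 0)"

definition proj2 :: "'a::chilbert_space \<times> 'a \<Rightarrow> 'a \<times> 'a" where
  "proj2 = block_op (\<lambda>_. 0) (\<lambda>_. 0) (\<lambda>_. 0) id"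

definition half_proj :: "('a \<Rightarrow> 'a) \<Rightarrow> 'a::chilbert_space \<times> 'a \<Rightarrow> 'a \<times> 'a" where
  "half_proj U = (\<lambda>p. (1/2) *\<^sub>C block_op id U (cadjoint U) id p)"

definition proj3 :: "'a::chilbert_space \<times> 'a \<Rightarrow> 'a \<times> 'a" where
  "proj3 = (\<lambda>p. (1/2) *\<^sub>C block_op id id id id p)"

definition system_UV ::
    "('a::chilbert_space \<Rightarrow> 'a) \<Rightarrow> ('a \<Rightarrow> 'a) \<Rightarrow> ('a \<times> 'a) set list" where
  "system_UV U V =
     [range proj1, range proj2, range proj3, range (half_proj U), range (half_proj V)]"

definition irreducible_pair ::
    "('a::chilbert_space \<Rightarrow> 'a) \<Rightarrow> ('a \<Rightarrow> 'a) \<Rightarrow> bool" where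
  "irreducible_pair U V \<longleftrightarrow>
     (\<forall>M. closed_csubspace M \<and> U ` M \<subseteq> M \<and> V ` M \<subseteq> M \<and>
          cadjoint U ` M \<subseteq> M \<and> cadjoint V ` M \<subseteq> M \<longrightarrow> M = {0} \<or> M = UNIV)"

definition unitarily_equivalent_pairs ::
    "('a::chilbert_space \<Rightarrow> 'a) \<Rightarrow> ('a \<Rightarrow> 'a) \<Rightarrow>
     ('b::chilbert_space \<Rightarrow> 'b) \<Rightarrow> ('b \<Rightarrow> 'b) \<Rightarrow> bool" where
  "unitarily_equivalent_pairs U V U' V' \<longleftrightarrow>
     (\<exists>W::'a \<Rightarrow> 'b. unitary W \<and> W \<circ> U = U' \<circ> W \<and> W \<circ> V = V' \<circ> W)"

lemma riesz_real:
  fixes f :: "'a::{real_inner,complete_space} \<Rightarrow> real"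
  assumes f: "bounded_linear f"
  shows "\<exists>z. \<forall>x. f x = inner z x"
proof -
  interpret f: bounded_linear f by (rule f)
  define J where "J x = (norm x)\<^sup>2 - 2 * f x" for x
  obtain K where K: "\<And>x. norm (f x) \<le> norm x * K" using f.bounded by blast
  have low: "J x \<ge> - K\<^sup>2" for x
  proof -
    have "f x \<le> norm x * K" using K[of x] by simp
    moreover have "0 \<le> (norm x - K)\<^sup>2" by simp
    ultimately show ?thesis unfolding J_def power2_diff by (simp add: algebra_simps)
  qed
  define d where "d = (INF x. J x)"
  have bdd: "bdd_below (range J)" using low by (auto intro!: bdd_belowI2)
  have dle: "d \<le> J x" for x unfolding d_def using bdd by (rule cINF_lower) simp
  have "\<exists>x. J x < d + 1 / real (Suc n)" for n
  proof (rule ccontr)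
    assume "\<nexists>x. J x < d + 1 / real (Suc n)"
    then have "d + 1 / real (Suc n) \<le> d"
      by (subst (2) d_def, intro cINF_greatest) (auto simp: not_less)
    then show False by simp
  qed
  then obtain X where X: "\<And>n. J (X n) < d + 1 / real (Suc n)" by metis
  have par: "(norm (x - y))\<^sup>2 \<le> 2 * (J x + J y - 2 * d)" for x y
  proof -
    have "J x + J y = 2 * J ((1/2) *\<^sub>R (x + y)) + (norm (x - y))\<^sup>2 / 2"
      unfolding J_def power2_norm_eq_inner
      by (simp add: f.scaleR f.add inner_simps inner_commute field_simps)
    with dle[of "(1/2) *\<^sub>R (x + y)"] show ?thesis by simp
  qed
  have "Cauchy X"
  proof (rule metric_CauchyI)
    fix e :: real assume e: "e > 0"
    then obtain N where N: "1 / real (Suc N) < e\<^sup>2 / 4"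
      using nat_approx_posE[of "e\<^sup>2 / 4"] by auto
    have "dist (X m) (X n) < e" if "m \<ge> N" "n \<ge> N" for m n
    proof -
      have small: "1 / real (Suc k) \<le> 1 / real (Suc N)" if "k \<ge> N" for k
        using that by (simp add: frac_le)
      have J: "J (X k) < d + e\<^sup>2 / 4" if "k \<ge> N" for k
        using X[of k] small[OF that] N by argo
      have "(norm (X m - X n))\<^sup>2 < e\<^sup>2"
        using par[of "X m" "X n"] J[OF that(1)] J[OF that(2)] by argo
      then show ?thesis using e by (simp add: dist_norm power_less_imp_less_base)
    qed
    then show "\<exists>M. \<forall>m\<ge>M. \<forall>n\<ge>M. dist (X m) (X n) < e" by blast
  qed
  then obtain z where z: "X \<longlonglongrightarrow> z"
    using Cauchy_convergent_iff convergent_def by blast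
  have "(\<lambda>n. J (X n)) \<longlonglongrightarrow> J z"
    unfolding J_def by (intro tendsto_intros z f.tendsto)
  moreover have "(\<lambda>n. d + 1 / real (Suc n)) \<longlonglongrightarrow> d + 0"
    by (intro tendsto_intros LIMSEQ_Suc lim_1_over_n)
  ultimately have "J z \<le> d + 0"
    by (rule LIMSEQ_le) (use X in \<open>auto intro: less_imp_le\<close>)
  then have min: "J z \<le> J x" for x using dle[of x] by simp
  have "f y = inner z y" for y
  proof (cases "y = 0")
    case False
    define a where "a = inner z y - f y"
    define t where "t = - a / (norm y)\<^sup>2"
    have n: "(norm y)\<^sup>2 > 0" using False by simp
    have "J (z + t *\<^sub>R y) - J z = 2 * t * a + t\<^sup>2 * (norm y)\<^sup>2"
      unfolding J_def a_def power2_norm_eq_inner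
      by (simp add: f.scaleR f.add inner_simps inner_commute power2_eq_square algebra_simps)
    also have "\<dots> = - a\<^sup>2 / (norm y)\<^sup>2"
      unfolding t_def using n by (simp add: power2_eq_square field_simps)
    finally have "a\<^sup>2 / (norm y)\<^sup>2 \<le> 0" using min[of "z + t *\<^sub>R y"] by simp
    then have "a = 0" using n by (simp add: divide_le_0_iff)
    then show ?thesis by (simp add: a_def)
  qed (simp add: f.zero)
  then show ?thesis by blast
qed

lemma cinner_add_right:
  "cinner x (y + z) = cinner x y + cinner (x::'a::chilbert_space) z"
  unfolding cinner_commute[of x] cinner_add_left by simp

lemma cinner_scaleC_right:
  "cinner x (c *\<^sub>C y) = cnj c * cinner (x::'a::chilbert_space) y"
  unfolding cinner_commute[of x] cinner_scaleC_left by simp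

lemma cinner_eqI:
  fixes y z :: "'a::chilbert_space"
  assumes "\<And>x. cinner x y = cinner x z"
  shows "y = z"
proof -
  have "inner x y = inner x z" for x using assms by (simp add: inner_Re_cinner)
  then show ?thesis using vector_eq_ldot[of y z] by blast
qed

lemma Im_cinner:
  fixes x y :: "'a::chilbert_space"
  shows "Im (cinner x y) = - Re (cinner (\<i> *\<^sub>C x) y)"
  by (simp add: cinner_scaleC_left)

lemma cadjoint_works:
  assumes A: "bounded_clinear A"
  shows "cinner (A x) y = cinner x (cadjoint A y)"
proof -
  interpret A: bounded_linear A using A by (simp add: bounded_clinear_def)
  have "\<exists>z. \<forall>x. cinner (A x) y = cinner x z" for y
  proof -
    have "bounded_linear (\<lambda>x. inner (A x) y)"
      by (rule bounded_linear_compose[OF bounded_linear_inner_left A.bounded_linear_axioms])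
    from riesz_real[OF this] obtain z where z: "\<And>x. inner (A x) y = inner z x" by blast
    have re: "Re (cinner (A x) y) = Re (cinner x z)" for x
      using z[of x] unfolding inner_commute[of z] by (simp only: inner_Re_cinner)
    have "cinner (A x) y = cinner x z" for x
    proof (rule complex_eqI)
      show "Re (cinner (A x) y) = Re (cinner x z)" by (rule re)
      show "Im (cinner (A x) y) = Im (cinner x z)"
        unfolding Im_cinner using re[of "\<i> *\<^sub>C x"] A by (simp add: bounded_clinear_def)
    qed
    then show ?thesis by blast
  qed
  then have "\<exists>B. \<forall>x y. cinner (A x) y = cinner x (B y)" by metis
  then show ?thesis unfolding cadjoint_def by (rule someI2_ex) blast
qed

lemma cadjoint_unique:
  assumes "\<And>x y. cinner (A x) y = cinner x (B y)"
  shows "cadjoint A = B"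
proof -
  have "\<forall>x y. cinner (A x) y = cinner x (cadjoint A y)"
    unfolding cadjoint_def by (rule someI[of _ B]) (intro allI assms)
  then have "cinner x (cadjoint A y) = cinner x (B y)" for x y
    by (simp only: assms[symmetric])
  then show ?thesis by (intro ext cinner_eqI)
qed

lemma bounded_clinear_cadjoint:
  assumes A: "bounded_clinear A"
  shows "bounded_clinear (cadjoint A)"
proof -
  interpret A: bounded_linear A using A by (simp add: bounded_clinear_def)
  note w = cadjoint_works[OF A, symmetric]
  have add: "cadjoint A (x + y) = cadjoint A x + cadjoint A y" for x y
    by (rule cinner_eqI) (simp add: w cinner_add_right)
  have scale: "cadjoint A (c *\<^sub>C x) = c *\<^sub>C cadjoint A x" for c x
    by (rule cinner_eqI) (simp add: w cinner_scaleC_right)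
  obtain K where K: "\<And>x. norm (A x) \<le> norm x * K" and K0: "K > 0"
    using A.pos_bounded by blast
  have "norm (cadjoint A y) \<le> norm y * K" for y
  proof (cases "cadjoint A y = 0")
    case False
    let ?z = "cadjoint A y"
    have "norm ?z * norm ?z = inner (A ?z) y"
      unfolding inner_Re_cinner w[symmetric]
      by (simp only: power2_norm_eq_inner[unfolded power2_eq_square] inner_Re_cinner)
    also have "\<dots> \<le> norm (A ?z) * norm y" by (rule norm_cauchy_schwarz)
    also have "\<dots> \<le> norm ?z * K * norm y" by (intro mult_right_mono K) simp
    finally have "norm ?z * norm ?z \<le> norm ?z * (norm y * K)" by (simp only: mult_ac)
    then show ?thesis using False by (simp add: mult_le_cancel_left_pos)
  next
    case True
    then show ?thesis using K0 by simp
  qed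
  then have "bounded_linear (cadjoint A)"
    by (intro bounded_linear_intro[where K=K]) (simp_all add: add scale scaleR_scaleC)
  then show ?thesis by (simp add: bounded_clinear_def scale)
qed

lemma scaleC_0_right [simp]: "c *\<^sub>C (0::'a::chilbert_space) = 0"
  using scaleC_add_right[of c "0::'a" 0] by simp

lemma bounded_linear_scaleC: "bounded_linear (\<lambda>x::'a::chilbert_space. c *\<^sub>C x)"
proof (rule bounded_linear_intro[where K="cmod c"])
  fix x y :: 'a and r :: real
  have "cinner x x = complex_of_real ((norm x)\<^sup>2)"
    using cinner_commute[of x x]
    by (auto simp: complex_eq_iff power2_norm_eq_inner inner_Re_cinner)
  note xx = this
  show "c *\<^sub>C (x + y) = c *\<^sub>C x + c *\<^sub>C y" by (rule scaleC_add_right)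
  show "c *\<^sub>C (r *\<^sub>R x) = r *\<^sub>R (c *\<^sub>C x)"
    by (simp add: scaleR_scaleC scaleC_scaleC mult.commute)
  have "(norm (c *\<^sub>C x))\<^sup>2 = Re ((c * cnj c) * cinner x x)"
    by (simp only: power2_norm_eq_inner inner_Re_cinner cinner_scaleC_left cinner_scaleC_right
        mult.assoc mult.left_commute)
  also have "\<dots> = (norm x * cmod c)\<^sup>2"
    unfolding xx complex_norm_square[symmetric] of_real_mult[symmetric] Re_complex_of_real
    by (simp only: power_mult_distrib mult.commute)
  finally show "norm (c *\<^sub>C x) \<le> norm x * cmod c"
    by (simp add: power2_eq_iff_nonneg)
qed

lemma bounded_clinear_block_op:
  assumes "bounded_clinear A" "bounded_clinear B" "bounded_clinear C" "bounded_clinear D"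
  shows "bounded_clinear (block_op A B C D)"
proof -
  note l = assms[unfolded bounded_clinear_def]
  have "bounded_linear (\<lambda>p. (A (fst p) + B (snd p), C (fst p) + D (snd p)))"
    using l by (intro bounded_linear_Pair bounded_linear_add
        bounded_linear_compose[OF _ bounded_linear_fst]
        bounded_linear_compose[OF _ bounded_linear_snd]) auto
  then show ?thesis
    using l by (simp add: bounded_clinear_def block_op_def case_prod_unfold scaleC_prod_def
        scaleC_add_right)
qed

lemma bounded_clinear_id: "bounded_clinear id"
  by (simp add: bounded_clinear_def id_def bounded_linear_ident)

lemma bounded_clinear_zero: "bounded_clinear (\<lambda>_. 0)"
  by (simp add: bounded_clinear_def bounded_linear_zero)

lemma bounded_clinear_scaleC:
  assumes "bounded_clinear A"
  shows "bounded_clinear (\<lambda>x. c *\<^sub>C A x)"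
  using assms bounded_linear_compose[OF bounded_linear_scaleC, of A c]
  by (simp add: bounded_clinear_def scaleC_scaleC mult.commute)

lemma cadjoint_id: "cadjoint id = id"
  by (rule cadjoint_unique) simp

lemma unitary_id: "unitary id"
  by (simp add: unitary_def bounded_clinear_id cadjoint_id)

lemma proj3_eq: "proj3 = half_proj id"
  by (simp add: proj3_def half_proj_def cadjoint_id)

lemma scaleC_half_double: "(1/2) *\<^sub>C x + (1/2) *\<^sub>C x = (x::'a::chilbert_space)"
proof -
  have "(1/2) *\<^sub>C x + (1/2) *\<^sub>C x = (1/2 + 1/2) *\<^sub>C x"
    by (simp only: scaleC_add_left)
  also have "\<dots> = x" using scaleR_scaleC[of 1 x] by simp
  finally show ?thesis .
qed

lemma cinner_0_left [simp]: "cinner 0 (x::'a::chilbert_space) = 0"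
  using cinner_add_left[of 0 0 x] by simp

lemma cinner_0_right [simp]: "cinner (x::'a::chilbert_space) 0 = 0"
  using cinner_add_right[of x 0 0] by simp

lemma orthogonal_projection_proj1: "orthogonal_projection proj1"
  unfolding orthogonal_projection_def proj1_def
proof (intro conjI)
  show "cadjoint (block_op id (\<lambda>_. 0) (\<lambda>_. 0) (\<lambda>_. 0)) = block_op id (\<lambda>_. 0) (\<lambda>_. 0) (\<lambda>_. 0)"
    by (rule cadjoint_unique) (simp add: block_op_def case_prod_unfold cinner_prod_def)
qed (intro bounded_clinear_block_op bounded_clinear_id bounded_clinear_zero,
    simp add: block_op_def fun_eq_iff)

lemma orthogonal_projection_proj2: "orthogonal_projection proj2"
  unfolding orthogonal_projection_def proj2_def
proof (intro conjI)
  show "cadjoint (block_op (\<lambda>_. 0) (\<lambda>_. 0) (\<lambda>_. 0) id) = block_op (\<lambda>_. 0) (\<lambda>_. 0) (\<lambda>_. 0) id"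
    by (rule cadjoint_unique) (simp add: block_op_def case_prod_unfold cinner_prod_def)
qed (intro bounded_clinear_block_op bounded_clinear_id bounded_clinear_zero,
    simp add: block_op_def fun_eq_iff)

lemma orthogonal_projection_half_proj:
  assumes U: "unitary U"
  shows "orthogonal_projection (half_proj U)"
proof -
  have l: "bounded_clinear U" and UU: "\<And>x. cadjoint U (U x) = x" "\<And>x. U (cadjoint U x) = x"
    using U by (simp_all add: unitary_def fun_eq_iff)
  have l': "bounded_clinear (cadjoint U)" by (rule bounded_clinear_cadjoint[OF l])
  note w = cadjoint_works[OF l]
  have w': "cinner (cadjoint U x) y = cinner x (U y)" for x y
    unfolding cinner_commute[of _ y] cinner_commute[of _ "U y"] w by (simp only:)
  have add: "U (x + y) = U x + U y" "cadjoint U (x + y) = cadjoint U x + cadjoint U y" for x y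
    using l l' by (simp_all add: bounded_clinear_def bounded_linear.linear linear_add)
  have sc: "U (c *\<^sub>C x) = c *\<^sub>C U x" "cadjoint U (c *\<^sub>C x) = c *\<^sub>C cadjoint U x" for c x
    using l l' by (simp_all add: bounded_clinear_def)
  have "bounded_clinear (half_proj U)"
    unfolding half_proj_def
    by (intro bounded_clinear_scaleC bounded_clinear_block_op bounded_clinear_id l l')
  moreover have "half_proj U \<circ> half_proj U = half_proj U"
  proof
    fix p :: "'a \<times> 'a"
    obtain x y where p: "p = (x, y)" by fastforce
    define q where "q = (1/2) *\<^sub>C (x + U y)"
    define r where "r = (1/2) *\<^sub>C (cadjoint U x + y)"
    have "U r = q" "cadjoint U q = r"
      by (simp_all only: q_def r_def add sc UU)
    moreover have "half_proj U p = (q, r)"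
      by (simp add: p q_def r_def half_proj_def block_op_def scaleC_prod_def)
    ultimately have "block_op id U (cadjoint U) id (half_proj U p) = (q + q, r + r)"
      by (simp add: block_op_def)
    moreover have "(q + q, r + r) = block_op id U (cadjoint U) id p"
      by (simp only: p q_def r_def scaleC_half_double block_op_def prod.case id_apply)
    ultimately have "block_op id U (cadjoint U) id (half_proj U p) = block_op id U (cadjoint U) id p"
      by (simp only:)
    then show "(half_proj U \<circ> half_proj U) p = half_proj U p"
      by (simp add: half_proj_def[of U])
  qed
  moreover have "cadjoint (half_proj U) = half_proj U"
    by (rule cadjoint_unique)
      (simp add: half_proj_def block_op_def case_prod_unfold cinner_prod_def scaleC_prod_def
        cinner_scaleC_left cinner_scaleC_right cinner_add_left cinner_add_right w w'
        algebra_simps)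
  ultimately show ?thesis by (simp add: orthogonal_projection_def)
qed

lemma closed_csubspace_range_projection:
  assumes P: "orthogonal_projection P"
  shows "closed_csubspace (range P)"
proof -
  interpret P: bounded_linear P
    using P by (simp add: orthogonal_projection_def bounded_clinear_def)
  have idem: "P (P x) = P x" for x
    using P by (auto simp: orthogonal_projection_def fun_eq_iff)
  have sc: "P (c *\<^sub>C x) = c *\<^sub>C P x" for c x
    using P by (simp add: orthogonal_projection_def bounded_clinear_def)
  have eq: "range P = {x. P x = x}" using idem by (auto intro: range_eqI[OF sym])
  have "closed {x. P x = x}"
    by (intro closed_Collect_eq continuous_intros P.continuous_on)
  then show ?thesis
    unfolding closed_csubspace_def eq by (auto simp: P.zero P.add sc)
qed

lemma subspace_system_UV:
  assumes "unitary U" "unitary V"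
  shows "subspace_system 5 (system_UV U V)"
  using assms
  by (auto simp: subspace_system_def system_UV_def proj3_eq less_Suc_eq numeral_eq_Suc
      intro!: closed_csubspace_range_projection orthogonal_projection_proj1
      orthogonal_projection_proj2 orthogonal_projection_half_proj unitary_id)

end

theory Submission
  imports Defs
begin

text \<open>The five subspaces of the system are the two axes of \<open>H \<oplus> H\<close>, the diagonal, and the graphs of
  \<open>U\<^sup>*\<close> and \<open>V\<^sup>*\<close>. Hence a bounded operator that maps the subspaces of one such system into
  those of another is \<open>A \<oplus> A\<close> for an operator \<open>A\<close> that intertwines the two pairs (\<open>morphism_iff_intertwiner\<close>). Both claims thereby
  become statements about intertwiners of pairs of unitaries.

  Transitivity says that the commutant of \<open>U\<close> and \<open>V\<close> consists of scalars, and the first claim is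
  Schur's lemma. One direction uses the orthogonal projection onto an invariant subspace. For the
  other it suffices to treat a symmetric contraction \<open>A\<close> in the commutant. Its modulus
  \<open>B = |A|\<close> is in the commutant too, and \<open>(B - A)(B + A) = 0\<close>. Kernels of
  operators in the commutant are invariant subspaces, so \<open>B = A\<close> or \<open>B = -A\<close>, and \<open>A\<close> has a constant
  sign. After subtracting a Rayleigh quotient of \<open>A\<close> at a vector \<open>e\<close>, this sign forces \<open>e\<close> into
  the kernel, which is then the whole space
  (\<open>contraction_symmetric_commutant_zero\<close>). Neither the spectral theorem nor a functional calculus
  enters, only the existence of the modulus.

  An isomorphism of systems is an invertible intertwiner, and the second claim says that it can be
  replaced by a unitary one. This is its polar decomposition
  (\<open>bij_intertwiner_imp_unitary_intertwiner\<close>), which is built from the same modulus.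

  The modulus comes from an elementary iteration for the square root of \<open>1 - T\<close> with \<open>T\<close> a
  contraction (\<open>sqrt_one_minus_contraction\<close>), which converges in norm and keeps every
  commutation relation.\<close>

section \<open>Complex-linear operators\<close>

instance chilbert_space \<subseteq> banach ..

lemma bounded_clinear_bounded_linear: "bounded_clinear A \<Longrightarrow> bounded_linear A"
  by (simp add: bounded_clinear_def)

lemma bounded_clinear_scaleC_commute: "bounded_clinear A \<Longrightarrow> A (c *\<^sub>C x) = c *\<^sub>C A x"
  by (simp add: bounded_clinear_def)

lemma bounded_clinear_add: "bounded_clinear A \<Longrightarrow> A (x + y) = A x + A y"
  by (simp add: bounded_clinear_def bounded_linear.linear linear_add)

lemma bounded_clinear_diff: "bounded_clinear A \<Longrightarrow> A (x - y) = A x - A y"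
  by (simp add: bounded_clinear_def bounded_linear.linear linear_diff)

lemma bounded_clinear_zero_right: "bounded_clinear A \<Longrightarrow> A 0 = 0"
  by (simp add: bounded_clinear_def bounded_linear.linear linear_0)

lemmas bounded_clinear_simps =
  bounded_clinear_scaleC_commute bounded_clinear_add bounded_clinear_diff bounded_clinear_zero_right

lemma scaleC_diff_right: "c *\<^sub>C (x - y) = c *\<^sub>C x - c *\<^sub>C (y::'a::chilbert_space)"
  using scaleC_add_right[of c "x - y" y] by simp

lemma scaleC_one: "1 *\<^sub>C x = (x::'a::chilbert_space)"
  using scaleR_scaleC[of 1 x] by simp

lemma scaleC_0_left: "0 *\<^sub>C x = (0::'a::chilbert_space)"
  using scaleR_scaleC[of 0 x] by simp

lemma bounded_clinear_plus:
  "bounded_clinear A \<Longrightarrow> bounded_clinear B \<Longrightarrow> bounded_clinear (\<lambda>x. A x + B x)"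
  by (auto simp: bounded_clinear_def scaleC_add_right intro: bounded_linear_add)

lemma bounded_clinear_minus:
  "bounded_clinear A \<Longrightarrow> bounded_clinear B \<Longrightarrow> bounded_clinear (\<lambda>x. A x - B x)"
  by (auto simp: bounded_clinear_def scaleC_diff_right intro: bounded_linear_sub)

lemma inner_cadjoint_right: "bounded_clinear A \<Longrightarrow> inner x (cadjoint A y) = inner (A x) y"
  by (simp add: inner_Re_cinner cadjoint_works)

lemma inner_cadjoint_left: "bounded_clinear A \<Longrightarrow> inner (cadjoint A x) y = inner x (A y)"
  by (metis inner_commute inner_cadjoint_right)

lemma cadjoint_eqI_inner:
  assumes A: "bounded_clinear A" and eq: "\<And>x y. inner (A x) y = inner x (B y)"
  shows "cadjoint A = B"
proof
  fix y
  have "inner x (cadjoint A y) = inner x (B y)" for x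
    by (simp add: inner_cadjoint_right[OF A] eq)
  then show "cadjoint A y = B y" using vector_eq_ldot by blast
qed

lemma cadjoint_cadjoint: "bounded_clinear A \<Longrightarrow> cadjoint (cadjoint A) = A"
  by (rule cadjoint_eqI_inner[OF bounded_clinear_cadjoint inner_cadjoint_left])

lemma unitary_bounded_clinear: "unitary U \<Longrightarrow> bounded_clinear U"
  by (simp add: unitary_def)

lemma unitary_cancel:
  assumes "unitary U"
  shows "cadjoint U (U x) = x" "U (cadjoint U y) = y"
  using assms by (simp_all add: unitary_def fun_eq_iff)

lemma unitary_cadjoint: "unitary U \<Longrightarrow> unitary (cadjoint U)"
  by (simp add: unitary_def bounded_clinear_cadjoint cadjoint_cadjoint)

lemma unitary_bij: "unitary U \<Longrightarrow> bij U"
  by (metis unitary_def o_bij)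

text \<open>A unitary has its adjoint as its inverse, so an intertwiner of \<open>U\<close> and \<open>U'\<close> also intertwines
  their adjoints. This makes the set of operators commuting with \<open>U\<close> and \<open>V\<close> closed under taking
  adjoints, and lets the graphs of the adjoints in the system be traded for \<open>U\<close> and \<open>V\<close>.\<close>

lemma intertwines_cadjoint_iff:
  assumes "unitary U" "unitary U'"
  shows "(\<forall>x. A (cadjoint U x) = cadjoint U' (A x)) \<longleftrightarrow> (\<forall>x. A (U x) = U' (A x))"
  by (metis unitary_cancel assms)

lemma closed_csubspace_kernel:
  assumes A: "bounded_clinear A"
  shows "closed_csubspace {x. A x = 0}"
  using A unfolding closed_csubspace_def
  by (auto simp: bounded_clinear_simps intro!: closed_Collect_eq continuous_intros
      linear_continuous_on[OF bounded_clinear_bounded_linear])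

section \<open>Square roots and moduli\<close>

text \<open>If \<open>R\<close> is a fixed point of \<open>R \<mapsto> (T + R\<^sup>2) / 2\<close>, then \<open>(1 - R)\<^sup>2 = 1 - T\<close>. The iteration from
  \<open>0\<close> stays inside the closed algebra generated by \<open>T\<close>, so its limit commutes with whatever commutes
  with \<open>T\<close>.\<close>

fun sqrt_iterate :: "('a::{real_inner,banach} \<Rightarrow>\<^sub>L 'a) \<Rightarrow> nat \<Rightarrow> 'a \<Rightarrow>\<^sub>L 'a" where
  "sqrt_iterate T 0 = 0"
| "sqrt_iterate T (Suc n) = (1/2) *\<^sub>R (T + (sqrt_iterate T n o\<^sub>L sqrt_iterate T n))"

text \<open>The same iteration for the scalar \<open>T = 1\<close>. It increases to a limit, and it dominates the
  operator iteration for every contraction \<open>T\<close>; this gives convergence in norm even when the norm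
  of \<open>T\<close> is \<open>1\<close>, where the map is not a strict contraction.\<close>

fun sqrt_majorant :: "nat \<Rightarrow> real" where
  "sqrt_majorant 0 = 0"
| "sqrt_majorant (Suc n) = (1 + (sqrt_majorant n)\<^sup>2) / 2"

lemma sqrt_majorant_bounds: "0 \<le> sqrt_majorant n \<and> sqrt_majorant n \<le> 1"
proof (induction n)
  case (Suc n)
  then have "(sqrt_majorant n)\<^sup>2 \<le> 1" by (simp add: power_le_one)
  then show ?case by simp
qed simp

lemma sqrt_majorant_mono: "sqrt_majorant n \<le> sqrt_majorant (Suc n)"
proof -
  have "0 \<le> (1 - sqrt_majorant n)\<^sup>2" by simp
  then show ?thesis by (simp add: power2_diff)
qed

lemma sqrt_iterate_commute:
  fixes T :: "'a::{real_inner,banach} \<Rightarrow>\<^sub>L 'a"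
  assumes "\<And>x. blinfun_apply C (T x) = T (C x)"
  shows "blinfun_apply C (sqrt_iterate T n x) = sqrt_iterate T n (C x)"
  by (induction n arbitrary: x) (simp_all add: blinfun.bilinear_simps assms)

lemma sqrt_iterate_symmetric:
  fixes T :: "'a::{real_inner,banach} \<Rightarrow>\<^sub>L 'a"
  assumes "\<And>x y. inner (blinfun_apply T x) y = inner x (T y)"
  shows "inner (sqrt_iterate T n x) y = inner x (sqrt_iterate T n y)"
  by (induction n arbitrary: x y) (simp_all add: blinfun.bilinear_simps inner_simps assms)

lemma norm_sqrt_iterate:
  assumes "norm T \<le> 1"
  shows "norm (sqrt_iterate T n) \<le> sqrt_majorant n"
proof (induction n)
  case (Suc n)
  have "norm (sqrt_iterate T n o\<^sub>L sqrt_iterate T n) \<le> norm (sqrt_iterate T n) * norm (sqrt_iterate T n)"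
    by (rule norm_blinfun_compose)
  also have "\<dots> \<le> (sqrt_majorant n)\<^sup>2"
    unfolding power2_eq_square using Suc by (intro mult_mono) (auto simp: sqrt_majorant_bounds)
  finally show ?case
    using norm_triangle_ineq[of T "sqrt_iterate T n o\<^sub>L sqrt_iterate T n"] assms by simp
qed simp

text \<open>Since the iterates commute with one another, the difference of their squares factors, and
  \<open>R\<^bsub>n+2\<^esub> - R\<^bsub>n+1\<^esub> = (R\<^bsub>n+1\<^esub> - R\<^bsub>n\<^esub>)(R\<^bsub>n+1\<^esub> + R\<^bsub>n\<^esub>) / 2\<close>. Taking norms turns this into the identity
  that the scalar majorant satisfies.\<close>

lemma sqrt_iterate_step:
  assumes "norm T \<le> 1"
  shows "norm (sqrt_iterate T (Suc n) - sqrt_iterate T n) \<le> sqrt_majorant (Suc n) - sqrt_majorant n"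
proof (induction n)
  case 0
  then show ?case using assms by simp
next
  case (Suc n)
  let ?X = "sqrt_iterate T" and ?b = sqrt_majorant
  have c: "blinfun_apply (?X i) (?X j x) = ?X j (?X i x)" for i j x
    by (intro sqrt_iterate_commute) (rule sqrt_iterate_commute[symmetric], simp)
  have cT: "blinfun_apply (?X n) (T x) = T (?X n x)" for x
    by (rule sqrt_iterate_commute[symmetric]) simp
  have "?X (Suc (Suc n)) - ?X (Suc n)
      = (1/2) *\<^sub>R ((?X (Suc n) - ?X n) o\<^sub>L (?X (Suc n) + ?X n))"
    by (rule blinfun_eqI)
      (simp del: sqrt_iterate.simps add: sqrt_iterate.simps(2)[of T n]
        sqrt_iterate.simps(2)[of T "Suc n"] c cT blinfun.bilinear_simps algebra_simps)
  then have "norm (?X (Suc (Suc n)) - ?X (Suc n))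
      \<le> norm (?X (Suc n) - ?X n) * norm (?X (Suc n) + ?X n) / 2"
    using norm_blinfun_compose[of "?X (Suc n) - ?X n" "?X (Suc n) + ?X n"] by simp
  also have "\<dots> \<le> (?b (Suc n) - ?b n) * (?b (Suc n) + ?b n) / 2"
    using norm_triangle_mono[OF norm_sqrt_iterate[OF assms] norm_sqrt_iterate[OF assms], of "Suc n" n]
    by (intro divide_right_mono mult_mono Suc.IH)
      (simp_all del: sqrt_majorant.simps sqrt_iterate.simps add: sqrt_majorant_mono)
  also have "\<dots> = ?b (Suc (Suc n)) - ?b (Suc n)"
    unfolding sqrt_majorant.simps(2)[of "Suc n"] sqrt_majorant.simps(2)[of n]
    by (simp add: power2_eq_square field_simps)
  finally show ?case .
qed

lemma convergent_sqrt_iterate: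
  assumes "norm T \<le> 1"
  shows "convergent (sqrt_iterate T)"
proof -
  let ?X = "sqrt_iterate T" and ?b = sqrt_majorant
  have step: "norm (?X (n + k) - ?X n) \<le> ?b (n + k) - ?b n" for n k
  proof (induction k)
    case (Suc k)
    have "norm (?X (n + Suc k) - ?X n)
        \<le> norm (?X (Suc (n + k)) - ?X (n + k)) + norm (?X (n + k) - ?X n)"
      using norm_triangle_ineq[of "?X (Suc (n + k)) - ?X (n + k)" "?X (n + k) - ?X n"]
      by (simp del: sqrt_iterate.simps)
    then show ?case using Suc sqrt_iterate_step[OF assms, of "n + k"]
      by (simp del: sqrt_iterate.simps sqrt_majorant.simps)
  qed simp
  have "incseq ?b" by (rule incseq_SucI) (rule sqrt_majorant_mono)
  then obtain L where "?b \<longlonglongrightarrow> L" and le: "\<And>i. ?b i \<le> L"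
    using incseq_convergent[of ?b 1] sqrt_majorant_bounds by metis
  have "Cauchy ?X"
  proof (rule CauchyI')
    fix e :: real assume "e > 0"
    with \<open>?b \<longlonglongrightarrow> L\<close> obtain N where N: "\<And>n. n \<ge> N \<Longrightarrow> \<bar>?b n - L\<bar> < e"
      by (metis LIMSEQ_D real_norm_def)
    have "norm (?X m - ?X n) < e" if "m \<ge> N" "n > m" for m n
    proof -
      have "norm (?X m - ?X n) \<le> ?b n - ?b m"
        using step[of m "n - m"] that by (simp add: norm_minus_commute)
      then show ?thesis using N[OF that(1)] le[of n] le[of m] by linarith
    qed
    then show "\<exists>M. \<forall>m\<ge>M. \<forall>n>m. dist (?X m) (?X n) < e" unfolding dist_norm by blast
  qed
  then show ?thesis by (simp add: Cauchy_convergent_iff)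
qed

lemma sqrt_one_minus_contraction:
  fixes T :: "'a::{real_inner,banach} \<Rightarrow>\<^sub>L 'a"
  assumes T: "norm T \<le> 1" and sym: "\<And>x y. inner (T x) y = inner x (T y)"
  obtains R :: "'a \<Rightarrow>\<^sub>L 'a" where "norm R \<le> 1" "\<And>x. 2 *\<^sub>R R x = T x + R (R x)"
    "\<And>x y. inner (R x) y = inner x (R y)"
    "\<And>C x. (\<And>x. blinfun_apply C (T x) = T (C x)) \<Longrightarrow> C (R x) = R (C x)"
proof -
  let ?X = "sqrt_iterate T"
  obtain R where R: "?X \<longlonglongrightarrow> R"
    using convergent_sqrt_iterate[OF T] convergent_def by blast
  have pw: "(\<lambda>n. ?X n x) \<longlonglongrightarrow> R x" for x
    by (intro tendsto_intros R)
  show thesis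
  proof
    show "norm R \<le> 1"
      using norm_sqrt_iterate[OF T] sqrt_majorant_bounds
      by (intro LIMSEQ_le_const2[OF tendsto_norm[OF R]]) (metis order_trans)
    have "(\<lambda>n. 2 *\<^sub>R ?X (Suc n)) \<longlonglongrightarrow> 2 *\<^sub>R R"
      by (intro tendsto_intros LIMSEQ_Suc R)
    moreover have "(\<lambda>n. T + (?X n o\<^sub>L ?X n)) \<longlonglongrightarrow> T + (R o\<^sub>L R)"
      by (intro tendsto_intros R bounded_bilinear.tendsto[OF bounded_bilinear_blinfun_compose])
    ultimately have "2 *\<^sub>R R = T + (R o\<^sub>L R)"
      by (simp add: LIMSEQ_unique)
    then show "2 *\<^sub>R R x = T x + R (R x)" for x
      by (metis blinfun.add_left blinfun.scaleR_left blinfun_apply_blinfun_compose)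
    have "(\<lambda>n. inner (?X n x) y) \<longlonglongrightarrow> inner (R x) y" "(\<lambda>n. inner x (?X n y)) \<longlonglongrightarrow> inner x (R y)" for x y
      by (intro tendsto_intros pw)+
    then show "inner (R x) y = inner x (R y)" for x y
      unfolding sqrt_iterate_symmetric[OF sym] by (rule LIMSEQ_unique)
    show "C (R x) = R (C x)" if "\<And>x. blinfun_apply C (T x) = T (C x)" for C x
    proof (rule LIMSEQ_unique)
      show "(\<lambda>n. C (?X n x)) \<longlonglongrightarrow> C (R x)" by (intro tendsto_intros pw)
      show "(\<lambda>n. C (?X n x)) \<longlonglongrightarrow> R (C x)"
        using pw[of "C x"] by (simp add: sqrt_iterate_commute[OF that])
    qed
  qed
qed

text \<open>\<open>B\<close> is the modulus \<open>|A|\<close>, the square root of \<open>A\<^sup>* A\<close>, obtained as \<open>1 - R\<close> from the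
  contraction \<open>T = 1 - A\<^sup>* A\<close>. The bound on \<open>x - B x\<close> takes the place of positivity of \<open>B\<close>.
  Complex linearity of \<open>B\<close> is itself an instance of the commutation property, applied to
  multiplication by a scalar.\<close>

lemma contraction_modulus:
  fixes A :: "'a::chilbert_space \<Rightarrow> 'b::chilbert_space"
  assumes A: "bounded_clinear A" and contr: "\<And>x. norm (A x) \<le> norm x"
  obtains B :: "'a \<Rightarrow> 'a" where "bounded_clinear B" "\<And>x. B (B x) = cadjoint A (A x)"
    "\<And>x y. inner (B x) y = inner x (B y)" "\<And>x. norm (x - B x) \<le> norm x"
    "\<And>C x. bounded_clinear C \<Longrightarrow> (\<And>x. C (cadjoint A (A x)) = cadjoint A (A (C x)))
      \<Longrightarrow> C (B x) = B (C x)"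
proof -
  let ?A' = "cadjoint A"
  have A': "bounded_clinear ?A'" by (rule bounded_clinear_cadjoint[OF A])
  have contr': "norm (?A' y) \<le> norm y" for y
  proof -
    have "norm (?A' y) * norm (?A' y) = inner (A (?A' y)) y"
      by (simp add: inner_cadjoint_right[OF A, symmetric] power2_norm_eq_inner[symmetric]
          power2_eq_square)
    also have "\<dots> \<le> norm (A (?A' y)) * norm y" by (rule norm_cauchy_schwarz)
    also have "\<dots> \<le> norm (?A' y) * norm y" by (intro mult_right_mono contr) simp
    finally show ?thesis by (cases "?A' y = 0") simp_all
  qed
  define T where "T = Blinfun (\<lambda>x. x - ?A' (A x))"
  have T: "blinfun_apply T x = x - ?A' (A x)" for x
    unfolding T_def
    by (subst bounded_linear_Blinfun_apply)
      (intro bounded_linear_sub bounded_linear_ident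
        bounded_linear_compose[OF bounded_clinear_bounded_linear bounded_clinear_bounded_linear] A A',
        rule refl)
  have "norm T \<le> 1"
  proof (rule norm_blinfun_bound)
    fix x
    \<comment> \<open>Expanding the square leaves \<open>\<parallel>x\<parallel>\<^sup>2 - 2 \<parallel>A x\<parallel>\<^sup>2 + \<parallel>A\<^sup>* A x\<parallel>\<^sup>2\<close>, and the adjoint is a contraction too.\<close>
    have "(norm (T x))\<^sup>2 = (norm x)\<^sup>2 - 2 * (norm (A x))\<^sup>2 + (norm (?A' (A x)))\<^sup>2"
      unfolding T power2_norm_eq_inner
      by (simp add: inner_simps inner_cadjoint_right[OF A] inner_cadjoint_left[OF A] inner_commute)
    also have "\<dots> \<le> (norm x)\<^sup>2"
    proof -
      have "(norm (?A' (A x)))\<^sup>2 \<le> (norm (A x))\<^sup>2" by (intro power_mono contr') simp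
      then show ?thesis using zero_le_power2[of "norm (A x)"] by linarith
    qed
    finally show "norm (T x) \<le> 1 * norm x" by (simp add: power2_le_iff_abs_le)
  qed simp
  moreover have "inner (T x) y = inner x (T y)" for x y
    by (simp add: T inner_simps inner_cadjoint_right[OF A] inner_cadjoint_left[OF A])
  ultimately obtain R :: "'a \<Rightarrow>\<^sub>L 'a" where nR: "norm R \<le> 1" and R2: "\<And>x. 2 *\<^sub>R R x = T x + R (R x)"
    and symR: "\<And>x y. inner (R x) y = inner x (R y)"
    and comR: "\<And>C x. (\<And>x. blinfun_apply C (T x) = T (C x)) \<Longrightarrow> C (R x) = R (C x)"
    by (rule sqrt_one_minus_contraction) blast
  have com: "C (R x) = R (C x)"
    if C: "bounded_linear C" "\<And>x. C (?A' (A x)) = ?A' (A (C x))" for C x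
    using comR[of "Blinfun C" x] C
    by (simp add: bounded_linear_Blinfun_apply T linear_diff[OF bounded_linear.linear])
  show thesis
  proof
    let ?B = "\<lambda>x. x - R x"
    have "R (c *\<^sub>C x) = c *\<^sub>C R x" for c x
      using com[of "\<lambda>x. c *\<^sub>C x" x] A A' by (simp add: bounded_linear_scaleC bounded_clinear_simps)
    then have "bounded_clinear (blinfun_apply R)"
      by (simp add: bounded_clinear_def blinfun.bounded_linear_right)
    then show "bounded_clinear ?B"
      by (rule bounded_clinear_minus[OF bounded_clinear_id[unfolded id_def]])
    show "?B (?B x) = ?A' (A x)" for x
    proof -
      have "?B (?B x) = x - 2 *\<^sub>R R x + R (R x)"
        by (simp add: blinfun.bilinear_simps scaleR_2)
      then show ?thesis unfolding R2 T by simp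
    qed
    show "inner (?B x) y = inner x (?B y)" for x y
      by (simp add: inner_simps symR)
    show "norm (x - ?B x) \<le> norm x" for x
      using norm_blinfun[of R x] mult_right_mono[OF nR, of "norm x"] by simp
    show "C (?B x) = ?B (C x)" if "bounded_clinear C" "\<And>x. C (?A' (A x)) = ?A' (A (C x))" for C x
      using com[OF bounded_clinear_bounded_linear[OF that(1)] that(2)]
      by (simp add: bounded_clinear_diff[OF that(1)])
  qed
qed

section \<open>Orthogonal projections\<close>

text \<open>By the parallelogram law, the sets of almost nearest points of \<open>M\<close> have diameters tending to
  \<open>0\<close>, so completeness gives a nearest point. Moving it along \<open>m\<close> cannot decrease the
  distance, which forces orthogonality.\<close>

lemma nearest_point_orthogonal:
  fixes x :: "'a::{real_inner,complete_space}"
  assumes M: "subspace M" "closed M"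
  obtains a where "a \<in> M" "\<And>m. m \<in> M \<Longrightarrow> inner (x - a) m = 0"
proof -
  define d where "d = (INF m\<in>M. (norm (x - m))\<^sup>2)"
  define S where "S n = {m \<in> M. (norm (x - m))\<^sup>2 \<le> d + 1 / real (Suc n)}" for n
  have "M \<noteq> {}" using M(1) subspace_0 by blast
  have dle: "d \<le> (norm (x - m))\<^sup>2" if "m \<in> M" for m
    unfolding d_def by (rule cINF_lower) (use that in \<open>auto intro: bdd_belowI2[where m=0]\<close>)
  have par: "(norm (m - m'))\<^sup>2 \<le> 2 * ((norm (x - m))\<^sup>2 + (norm (x - m'))\<^sup>2 - 2 * d)"
    if "m \<in> M" "m' \<in> M" for m m'
  proof -
    have "(1/2) *\<^sub>R (m + m') \<in> M"
      using that M(1) by (intro subspace_scale subspace_add)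
    moreover have "(norm (x - m))\<^sup>2 + (norm (x - m'))\<^sup>2
        = 2 * (norm (x - (1/2) *\<^sub>R (m + m')))\<^sup>2 + (norm (m - m'))\<^sup>2 / 2"
      unfolding power2_norm_eq_inner by (simp add: inner_simps inner_commute field_simps)
    ultimately show ?thesis using dle[of "(1/2) *\<^sub>R (m + m')"] by simp
  qed
  obtain a where a: "\<And>n. a \<in> S n"
  proof (rule decreasing_closed_nest[of S])
    show "closed (S n)" for n
      unfolding S_def Collect_conj_eq
      by (intro closed_Int closed_Collect_le continuous_intros) (simp add: M(2))
    show "S n \<noteq> {}" for n
    proof
      assume "S n = {}"
      then have "d + 1 / real (Suc n) \<le> d"
        by (subst (2) d_def, intro cINF_greatest \<open>M \<noteq> {}\<close>) (auto simp: S_def not_le less_imp_le)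
      then show False by simp
    qed
    show "S n \<subseteq> S m" if "m \<le> n" for m n
    proof -
      have "1 / real (Suc n) \<le> 1 / real (Suc m)" using that by (intro frac_le) simp_all
      then have "t \<le> d + 1 / real (Suc m)" if "t \<le> d + 1 / real (Suc n)" for t
        using that by linarith
      then show ?thesis unfolding S_def by blast
    qed
    show "\<exists>n. \<forall>m\<in>S n. \<forall>m'\<in>S n. dist m m' < e" if "e > 0" for e
    proof -
      obtain n where n: "1 / real (Suc n) < e\<^sup>2 / 4"
        using nat_approx_posE[of "e\<^sup>2 / 4"] \<open>e > 0\<close>
        by (metis zero_less_divide_iff zero_less_numeral zero_less_power)
      have "dist m m' < e" if "m \<in> S n" "m' \<in> S n" for m m'
      proof -
        have "m \<in> M" "m' \<in> M" "(norm (x - m))\<^sup>2 \<le> d + 1 / real (Suc n)"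
            "(norm (x - m'))\<^sup>2 \<le> d + 1 / real (Suc n)"
          using that unfolding S_def by blast+
        moreover define r where "r = 1 / real (Suc n)"
        ultimately have "(norm (m - m'))\<^sup>2 < e\<^sup>2"
          using n par[of m m'] unfolding r_def[symmetric] by auto
        then show ?thesis
          unfolding dist_norm by (rule power_less_imp_less_base) (use \<open>e > 0\<close> in simp)
      qed
      then show ?thesis by blast
    qed
  qed (rule that)
  have "(norm (x - a))\<^sup>2 \<le> d"
  proof (rule field_le_epsilon)
    fix e :: real assume "e > 0"
    then obtain n where "1 / real (Suc n) < e" using nat_approx_posE by blast
    with a[of n] show "(norm (x - a))\<^sup>2 \<le> d + e" by (simp add: S_def)
  qed
  then have min: "(norm (x - a))\<^sup>2 \<le> (norm (x - m))\<^sup>2" if "m \<in> M" for m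
    using dle[OF that] by linarith
  have aM: "a \<in> M" using a[of 0] by (simp add: S_def)
  have "inner (x - a) m = 0" if "m \<in> M" for m
  proof (cases "m = 0")
    case False
    \<comment> \<open>The minimiser of the quadratic \<open>t \<mapsto> \<parallel>x - (a + t m)\<parallel>\<^sup>2\<close>.\<close>
    define t where "t = inner (x - a) m / (norm m)\<^sup>2"
    have n: "(norm m)\<^sup>2 > 0" using False by simp
    have "(norm (x - (a + t *\<^sub>R m)))\<^sup>2 = (norm (x - a))\<^sup>2 - 2 * t * inner (x - a) m + t\<^sup>2 * (norm m)\<^sup>2"
      unfolding power2_norm_eq_inner diff_diff_eq[symmetric]
      by (simp only: inner_diff_left[of "x - a"] inner_diff_right[of _ "x - a"]
          inner_scaleR_left inner_scaleR_right inner_commute[of m "x - a"])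
        (simp add: power2_eq_square algebra_simps)
    also have "\<dots> = (norm (x - a))\<^sup>2 - (inner (x - a) m)\<^sup>2 / (norm m)\<^sup>2"
      unfolding t_def using n by (simp add: power2_eq_square field_simps)
    finally have "(inner (x - a) m)\<^sup>2 / (norm m)\<^sup>2 \<le> 0"
      using min[of "a + t *\<^sub>R m"] that aM M(1) by (simp add: subspace_add subspace_scale)
    then show ?thesis using n by (simp add: divide_le_0_iff)
  qed simp
  with aM show thesis by (rule that)
qed

lemma closed_csubspace_subspace: "closed_csubspace M \<Longrightarrow> subspace M"
  by (simp add: closed_csubspace_def subspace_def scaleR_scaleC)

lemma inner_scaleC_left: "inner (c *\<^sub>C x) y = inner (x::'a::chilbert_space) (cnj c *\<^sub>C y)"
  by (simp add: inner_Re_cinner cinner_scaleC_left cinner_scaleC_right)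

lemma inner_cadjoint_scaleC:
  assumes "bounded_clinear A"
  shows "inner (c *\<^sub>C A x) y = inner x (cnj c *\<^sub>C cadjoint A y)"
    "inner (c *\<^sub>C cadjoint A x) y = inner x (cnj c *\<^sub>C A y)"
  using assms
  by (simp_all add: inner_scaleC_left inner_cadjoint_right[OF assms, symmetric] inner_cadjoint_left
      bounded_clinear_scaleC_commute bounded_clinear_cadjoint)

text \<open>If \<open>M\<close> is invariant under \<open>A\<close> and its adjoint, then \<open>A\<close> preserves both \<open>M\<close> and its orthogonal
  complement, hence the decomposition that defines the projection \<open>P\<close>.\<close>

lemma commuting_projection:
  fixes M :: "'a::chilbert_space set"
  assumes M: "closed_csubspace M"
  obtains P where "bounded_clinear P" "\<And>x. P x \<in> M" "\<And>x. x \<in> M \<Longrightarrow> P x = x"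
    "\<And>A x. bounded_clinear A \<Longrightarrow> A ` M \<subseteq> M \<Longrightarrow> cadjoint A ` M \<subseteq> M \<Longrightarrow> P (A x) = A (P x)"
proof -
  have sub: "subspace M" and "closed M"
    using M closed_csubspace_subspace by (auto simp: closed_csubspace_def)
  have scM: "c *\<^sub>C m \<in> M" if "m \<in> M" for c m
    using M that by (simp add: closed_csubspace_def)
  have "\<exists>a\<in>M. \<forall>m\<in>M. inner (x - a) m = 0" for x
    by (rule nearest_point_orthogonal[OF sub \<open>closed M\<close>, of x]) blast
  then obtain P where PM: "\<And>x. P x \<in> M" and orth: "\<And>x m. m \<in> M \<Longrightarrow> inner (x - P x) m = 0"
    by metis
  have uniq: "P x = a" if "a \<in> M" "\<And>m. m \<in> M \<Longrightarrow> inner (x - a) m = 0" for x a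
  proof -
    have "P x - a \<in> M" using PM that(1) sub by (simp add: subspace_diff)
    then have "inner (P x - a) (P x - a) = 0"
      using orth[of "P x - a" x] that(2)[of "P x - a"] by (simp add: inner_diff_left)
    then show ?thesis by simp
  qed
  show thesis
  proof
    have add: "P (x + y) = P x + P y" for x y
    proof (rule uniq)
      show "P x + P y \<in> M" using sub PM PM by (rule subspace_add)
      show "inner (x + y - (P x + P y)) m = 0" if "m \<in> M" for m
        using orth[OF that, of x] orth[OF that, of y] by (simp add: inner_simps)
    qed
    have scale: "P (c *\<^sub>C x) = c *\<^sub>C P x" for c x
    proof (rule uniq)
      show "inner (c *\<^sub>C x - c *\<^sub>C P x) m = 0" if "m \<in> M" for m
        using orth[OF scM[OF that]] by (simp add: scaleC_diff_right[symmetric] inner_scaleC_left)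
    qed (simp add: scM PM)
    have "norm (P x) \<le> norm x * 1" for x
    proof -
      have "norm (P x) * norm (P x) = inner x (P x)"
        using orth[OF PM, of x x] by (simp add: inner_diff_left power2_norm_eq_inner[symmetric] power2_eq_square)
      also have "\<dots> \<le> norm x * norm (P x)" by (rule norm_cauchy_schwarz)
      finally show ?thesis by (cases "P x = 0") simp_all
    qed
    then have "bounded_linear P"
      by (intro bounded_linear_intro[where K=1]) (simp_all add: add scale scaleR_scaleC)
    then show "bounded_clinear P" by (simp add: bounded_clinear_def scale)
    show "P x \<in> M" for x by (rule PM)
    show "P x = x" if "x \<in> M" for x by (rule uniq) (simp_all add: that)
    show "P (A x) = A (P x)"
      if A: "bounded_clinear A" and inv: "A ` M \<subseteq> M" "cadjoint A ` M \<subseteq> M" for A x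
    proof (rule uniq)
      show "A (P x) \<in> M" using inv(1) PM by blast
      show "inner (A x - A (P x)) m = 0" if "m \<in> M" for m
      proof -
        have "inner (A x - A (P x)) m = inner (x - P x) (cadjoint A m)"
          by (simp add: inner_cadjoint_right[OF A] bounded_clinear_diff[OF A])
        then show ?thesis using orth inv(2) that by auto
      qed
    qed
  qed
qed

section \<open>Intertwiners and the Schur lemma\<close>

definition intertwiner :: "('a::chilbert_space \<Rightarrow> 'a) \<Rightarrow> ('a \<Rightarrow> 'a) \<Rightarrow>
    ('b::chilbert_space \<Rightarrow> 'b) \<Rightarrow> ('b \<Rightarrow> 'b) \<Rightarrow> ('a \<Rightarrow> 'b) \<Rightarrow> bool" where
  "intertwiner U V U' V' A \<longleftrightarrow>
     bounded_clinear A \<and> (\<forall>x. A (U x) = U' (A x)) \<and> (\<forall>x. A (V x) = V' (A x))"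

lemma cadjoint_intertwines:
  assumes A: "bounded_clinear A" and "unitary U" "unitary U'" and eq: "\<And>x. A (U x) = U' (A x)"
  shows "cadjoint A (U' y) = U (cadjoint A y)"
proof -
  have U: "bounded_clinear U" and U': "bounded_clinear U'"
    using assms unitary_bounded_clinear by blast+
  have "A (cadjoint U x) = cadjoint U' (A x)" for x
    using intertwines_cadjoint_iff[OF assms(2,3)] eq by blast
  then have "inner x (cadjoint A (U' y)) = inner x (U (cadjoint A y))" for x
    by (simp add: inner_cadjoint_right[OF A] inner_cadjoint_left[OF U, symmetric]
        inner_cadjoint_left[OF U', symmetric])
  then show ?thesis using vector_eq_ldot by blast
qed

lemma intertwiner_cadjoint:
  assumes "unitary U" "unitary V" "unitary U'" "unitary V'" "intertwiner U V U' V' A"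
  shows "intertwiner U' V' U V (cadjoint A)"
  using assms by (simp add: intertwiner_def bounded_clinear_cadjoint cadjoint_intertwines)

text \<open>The kernel of an operator in the commutant is a reducing subspace, so under irreducibility it
  is zero or everything. In particular the commutant has no zero divisors.\<close>

lemma irreducible_kernel:
  assumes U: "unitary U" "unitary V" and irr: "irreducible_pair U V"
    and A: "intertwiner U V U V A" and e: "A e = 0" "e \<noteq> 0"
  shows "A x = 0"
proof -
  let ?K = "{x. A x = 0}"
  have A': "bounded_clinear A" "A (U x) = U (A x)" "A (V x) = V (A x)" for x
    using A by (auto simp: intertwiner_def)
  have "A (cadjoint U x) = cadjoint U (A x)" "A (cadjoint V x) = cadjoint V (A x)" for x
    using intertwines_cadjoint_iff[of _ _ A] A' U by blast+
  moreover have "T 0 = 0" if "T \<in> {U, V, cadjoint U, cadjoint V}" for T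
    using that U by (auto intro!: bounded_clinear_zero_right unitary_bounded_clinear unitary_cadjoint)
  ultimately have "U ` ?K \<subseteq> ?K" "V ` ?K \<subseteq> ?K" "cadjoint U ` ?K \<subseteq> ?K" "cadjoint V ` ?K \<subseteq> ?K"
    using A' by auto
  then have "?K = {0} \<or> ?K = UNIV"
    by (intro irr[unfolded irreducible_pair_def, THEN spec, THEN mp] conjI
        closed_csubspace_kernel[OF A'(1)])
  then show ?thesis using e by auto
qed

text \<open>Core of the Schur lemma. The modulus \<open>B = |A|\<close> lies in the commutant and
  \<open>(B - A)(B + A) = B\<^sup>2 - A\<^sup>2 = 0\<close>. As there are no zero divisors, \<open>B\<close> is \<open>A\<close> or \<open>-A\<close>: a symmetric
  operator in the commutant has a constant sign. A semidefinite form that vanishes at \<open>e\<close> has \<open>e\<close> in the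
  kernel of its operator, and that kernel must then be everything.\<close>

lemma contraction_symmetric_commutant_zero:
  assumes U: "unitary U" "unitary V" and irr: "irreducible_pair U V"
    and A: "intertwiner U V U V A" and contr: "\<And>x. norm (A x) \<le> norm x"
    and sym: "\<And>x y. inner (A x) y = inner x (A y)"
    and e: "inner (A e) e = 0" "e \<noteq> 0"
  shows "A x = 0"
proof -
  have lin: "bounded_clinear A" and com: "A (U x) = U (A x)" "A (V x) = V (A x)" for x
    using A by (auto simp: intertwiner_def)
  have adj: "cadjoint A = A" by (rule cadjoint_eqI_inner[OF lin sym])
  obtain B where B: "bounded_clinear B" and BB: "\<And>x. B (B x) = A (A x)"
    and "\<And>x y. inner (B x) y = inner x (B y)" and cB: "\<And>x. norm (x - B x) \<le> norm x"
    and comB: "\<And>C x. bounded_clinear C \<Longrightarrow> (\<And>x. C (A (A x)) = A (A (C x))) \<Longrightarrow> C (B x) = B (C x)"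
    by (fact contraction_modulus[OF lin contr, unfolded adj])
  have UV: "bounded_clinear U" "bounded_clinear V" using U unitary_bounded_clinear by blast+
  have AB: "A (B x) = B (A x)" for x by (rule comB[OF lin]) simp
  have BU: "B (U x) = U (B x)" for x by (rule comB[OF UV(1), symmetric]) (simp add: com)
  have BV: "B (V x) = V (B x)" for x by (rule comB[OF UV(2), symmetric]) (simp add: com)
  have diff: "intertwiner U V U V (\<lambda>x. B x - A x)"
    using UV B lin by (simp add: intertwiner_def com BU BV bounded_clinear_minus bounded_clinear_diff)
  have prod: "B (B x + A x) - A (B x + A x) = 0" for x
    using B lin by (simp add: bounded_clinear_add AB BB)
  \<comment> \<open>At the single vector \<open>e\<close>, the dichotomy already gives \<open>B e = - A e\<close> or \<open>B e = A e\<close>.\<close>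
  have "inner (B e) e = 0 \<and> (B e = 0 \<longrightarrow> A e = 0)"
  proof (cases "B e + A e = 0")
    case True
    then have "A e = - B e" by (simp add: eq_neg_iff_add_eq_0 add.commute)
    then show ?thesis using e(1) by simp
  next
    case False
    have "B e - A e = 0"
      using irreducible_kernel[OF U irr diff prod False] .
    then show ?thesis using e(1) by simp
  qed
  moreover have "B e = 0" if "inner (B e) e = 0"
  proof -
    \<comment> \<open>\<open>\<parallel>e - B e\<parallel>\<^sup>2 = \<parallel>e\<parallel>\<^sup>2 + \<parallel>B e\<parallel>\<^sup>2\<close> because the cross term vanishes.\<close>
    have "(norm (e - B e))\<^sup>2 \<le> (norm e)\<^sup>2" using cB by (intro power_mono) simp_all
    then have "inner (B e) (B e) \<le> 0"
      using that unfolding power2_norm_eq_inner by (simp add: inner_simps inner_commute)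
    then show ?thesis by (metis inner_ge_zero inner_eq_zero_iff order_antisym)
  qed
  ultimately have "A e = 0" by blast
  then show ?thesis by (rule irreducible_kernel[OF U irr A _ e(2)])
qed

lemma intertwiner_combination:
  assumes "unitary U" "unitary V"
    and A: "intertwiner U V U V A" and B: "intertwiner U V U V B"
  shows "intertwiner U V U V (\<lambda>x. a *\<^sub>C A x + b *\<^sub>C B x)"
proof -
  have UV: "bounded_clinear U" "bounded_clinear V" using assms unitary_bounded_clinear by blast+
  have "bounded_clinear (\<lambda>x. a *\<^sub>C A x + b *\<^sub>C B x)"
    using A B by (intro bounded_clinear_plus bounded_clinear_scaleC) (simp_all add: intertwiner_def)
  then show ?thesis
    using A B unfolding intertwiner_def
    by (simp add: bounded_clinear_add[OF UV(1)] bounded_clinear_add[OF UV(2)]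
        bounded_clinear_scaleC_commute[OF UV(1)] bounded_clinear_scaleC_commute[OF UV(2)])
qed

lemma bounded_clinear_contraction_multiple:
  assumes "bounded_clinear A"
  obtains r :: real where "r > 0" "\<And>x. norm (complex_of_real r *\<^sub>C A x) \<le> norm x"
proof -
  obtain K where K: "K > 0" "\<And>x. norm (A x) \<le> norm x * K"
    using bounded_linear.pos_bounded[OF bounded_clinear_bounded_linear[OF assms]] by blast
  show thesis
  proof (rule that[of "1 / K"])
    show "norm (complex_of_real (1 / K) *\<^sub>C A x) \<le> norm x" for x
      unfolding scaleR_scaleC[symmetric] using K by (simp add: field_simps)
  qed (use K in simp)
qed

lemma symmetric_commutant_scalar:
  assumes UV: "unitary U" "unitary V" and irr: "irreducible_pair U V"
    and A: "intertwiner U V U V A" and sym: "\<And>x y. inner (A x) y = inner x (A y)"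
  obtains r :: real where "\<And>x. A x = complex_of_real r *\<^sub>C x"
proof (cases "\<exists>e::'a. e \<noteq> 0")
  case True
  then obtain e :: 'a where e: "e \<noteq> 0" by blast
  \<comment> \<open>With the Rayleigh quotient as \<open>r\<close>, the form of \<open>A - r\<close> vanishes at \<open>e\<close>.\<close>
  define r where "r = inner (A e) e / inner e e"
  define D where "D x = 1 *\<^sub>C A x + complex_of_real (- r) *\<^sub>C x" for x
  have Deq: "D x = A x - r *\<^sub>R x" for x
    unfolding D_def scaleR_scaleC[symmetric] by (simp add: scaleC_one)
  have D: "intertwiner U V U V D"
    unfolding D_def
    by (rule intertwiner_combination[OF UV A]) (simp add: intertwiner_def bounded_clinear_id[unfolded id_def])
  then have linD: "bounded_clinear D" by (simp add: intertwiner_def)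
  obtain s :: real where s: "s > 0" "\<And>x. norm (complex_of_real s *\<^sub>C D x) \<le> norm x"
    by (rule bounded_clinear_contraction_multiple[OF linD]) blast
  have E: "intertwiner U V U V (\<lambda>x. complex_of_real s *\<^sub>C D x)"
    using intertwiner_combination[OF UV D D, of "complex_of_real s" 0] by (simp add: scaleC_0_left)
  have "complex_of_real s *\<^sub>C D x = 0" for x
  proof (rule contraction_symmetric_commutant_zero[OF UV irr E s(2) _ _ e])
    show "inner (complex_of_real s *\<^sub>C D x) y = inner x (complex_of_real s *\<^sub>C D y)" for x y
      unfolding scaleR_scaleC[symmetric] Deq by (simp add: inner_simps sym)
    show "inner (complex_of_real s *\<^sub>C D e) e = 0"
      unfolding scaleR_scaleC[symmetric] Deq using e by (simp add: inner_simps r_def)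
  qed
  then have "A x = complex_of_real r *\<^sub>C x" for x
    unfolding scaleR_scaleC[symmetric] Deq using s(1) by simp
  then show thesis by (rule that)
next
  case False
  then have "x = y" for x y :: 'a by metis
  then show thesis using that by blast
qed

lemma irreducible_commutant_scalar:
  assumes UV: "unitary U" "unitary V" and irr: "irreducible_pair U V"
    and A: "intertwiner U V U V A"
  obtains c where "\<And>x. A x = c *\<^sub>C x"
proof -
  let ?A' = "cadjoint A"
  have A': "intertwiner U V U V ?A'" by (rule intertwiner_cadjoint[OF UV UV A])
  have lin: "bounded_clinear A" using A by (simp add: intertwiner_def)
  note adj = inner_cadjoint_right[OF lin] inner_cadjoint_left[OF lin]
  define X where "X x = 1 *\<^sub>C A x + 1 *\<^sub>C ?A' x" for x
  define Y where "Y x = \<i> *\<^sub>C A x + (- \<i>) *\<^sub>C ?A' x" for x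
  obtain p :: real where p: "\<And>x. X x = complex_of_real p *\<^sub>C x"
  proof (rule symmetric_commutant_scalar[OF UV irr])
    show "intertwiner U V U V X"
      unfolding X_def by (rule intertwiner_combination[OF UV A A'])
    show "inner (X x) y = inner x (X y)" for x y
      by (simp add: X_def scaleC_one inner_simps adj)
  qed blast
  obtain q :: real where q: "\<And>x. Y x = complex_of_real q *\<^sub>C x"
  proof (rule symmetric_commutant_scalar[OF UV irr])
    show "intertwiner U V U V Y"
      unfolding Y_def by (rule intertwiner_combination[OF UV A A'])
    show "inner (Y x) y = inner x (Y y)" for x y
      by (simp add: Y_def inner_add_left inner_add_right inner_cadjoint_scaleC[OF lin] add.commute)
  qed blast
  \<comment> \<open>\<open>X = A + A\<^sup>*\<close> and \<open>Y = \<i> (A - A\<^sup>*)\<close> are symmetric, and \<open>A = (X - \<i> Y) / 2\<close>.\<close>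
  have "A x = (1/2 * (complex_of_real p - \<i> * complex_of_real q)) *\<^sub>C x" for x
  proof -
    have "(1/2) *\<^sub>C X x + (- \<i>/2) *\<^sub>C Y x
        = ((1/2) *\<^sub>C A x + (1/2) *\<^sub>C A x) + ((1/2) *\<^sub>C ?A' x + (-1/2) *\<^sub>C ?A' x)"
      by (simp add: X_def Y_def scaleC_add_right scaleC_scaleC)
    also have "\<dots> = A x"
      unfolding scaleC_add_left[symmetric] by (simp add: scaleC_one scaleC_0_left)
    finally show ?thesis
      unfolding p q scaleC_scaleC scaleC_add_left[symmetric] by (simp add: algebra_simps)
  qed
  then show thesis by (rule that)
qed

text \<open>Conversely to the Schur lemma, the orthogonal projection onto a reducing subspace is in the
  commutant; a scalar that fixes a nonzero vector is \<open>1\<close>.\<close>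

lemma irreducible_iff_commutant_scalar:
  assumes UV: "unitary U" "unitary V"
  shows "irreducible_pair U V \<longleftrightarrow> (\<forall>A. intertwiner U V U V A \<longrightarrow> (\<exists>c. \<forall>x. A x = c *\<^sub>C x))"
proof
  show "\<forall>A. intertwiner U V U V A \<longrightarrow> (\<exists>c. \<forall>x. A x = c *\<^sub>C x)" if "irreducible_pair U V"
    by (intro allI impI, erule irreducible_commutant_scalar[OF UV that], blast)
next
  assume scalar: "\<forall>A. intertwiner U V U V A \<longrightarrow> (\<exists>c. \<forall>x. A x = c *\<^sub>C x)"
  have "M = {0} \<or> M = UNIV" if M: "closed_csubspace M" and inv: "U ` M \<subseteq> M" "V ` M \<subseteq> M"
      "cadjoint U ` M \<subseteq> M" "cadjoint V ` M \<subseteq> M" for M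
  proof (cases "M = {0}")
    case False
    then obtain m where m: "m \<in> M" "m \<noteq> 0"
      using M by (auto simp: closed_csubspace_def)
    obtain P where P: "bounded_clinear P" "\<And>x. P x \<in> M" "\<And>x. x \<in> M \<Longrightarrow> P x = x"
      "\<And>A x. bounded_clinear A \<Longrightarrow> A ` M \<subseteq> M \<Longrightarrow> cadjoint A ` M \<subseteq> M \<Longrightarrow> P (A x) = A (P x)"
      by (fact commuting_projection[OF M])
    have "intertwiner U V U V P"
      using P inv UV by (simp add: intertwiner_def unitary_bounded_clinear)
    then obtain c where c: "\<And>x. P x = c *\<^sub>C x" using scalar by blast
    have "c \<noteq> 0" using c[of m] P(3)[OF m(1)] m(2) by (auto simp: scaleC_0_left)
    then have "x = (1 / c) *\<^sub>C P x" for x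
      by (simp add: c scaleC_scaleC scaleC_one)
    then have "x \<in> M" for x
      using P(2) M by (metis closed_csubspace_def)
    then show ?thesis by blast
  qed simp
  then show "irreducible_pair U V" by (simp add: irreducible_pair_def)
qed

section \<open>Morphisms between systems of five subspaces\<close>

lemma range_half_proj:
  assumes U: "unitary U"
  shows "range (half_proj U) = range (\<lambda>x. (x, cadjoint U x))"
proof (intro equalityI image_subsetI)
  fix p :: "'a \<times> 'a"
  obtain a b where p: "p = (a, b)" by fastforce
  have "half_proj U p = ((1/2) *\<^sub>C (a + U b), cadjoint U ((1/2) *\<^sub>C (a + U b)))"
    using bounded_clinear_cadjoint[OF unitary_bounded_clinear[OF U]]
    by (simp add: p half_proj_def block_op_def scaleC_prod_def bounded_clinear_simps unitary_cancel[OF U])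
  then show "half_proj U p \<in> range (\<lambda>x. (x, cadjoint U x))" by simp
next
  fix x
  have "half_proj U (x, cadjoint U x) = (x, cadjoint U x)"
    by (simp add: half_proj_def block_op_def scaleC_prod_def unitary_cancel[OF U] scaleC_add_right
        scaleC_half_double)
  then show "(x, cadjoint U x) \<in> range (half_proj U)" by (metis rangeI)
qed

lemma system_UV_graphs:
  assumes "unitary U" "unitary V"
  shows "system_UV U V = [range (\<lambda>x. (x, 0)), range (\<lambda>x. (0, x)), range (\<lambda>x. (x, x)),
      range (\<lambda>x. (x, cadjoint U x)), range (\<lambda>x. (x, cadjoint V x))]"
proof -
  have "range (proj1 :: 'a \<times> 'a \<Rightarrow> _) = range (\<lambda>x. (x, 0))"
    by (auto simp: proj1_def block_op_def image_iff)
  moreover have "range (proj2 :: 'a \<times> 'a \<Rightarrow> _) = range (\<lambda>x. (0, x))"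
    by (auto simp: proj2_def block_op_def image_iff)
  moreover have "range (proj3 :: 'a \<times> 'a \<Rightarrow> _) = range (\<lambda>x. (x, x))"
    by (simp add: proj3_eq range_half_proj[OF unitary_id] cadjoint_id)
  ultimately show ?thesis by (simp add: system_UV_def range_half_proj assms)
qed

lemma bounded_clinear_map_prod:
  assumes "bounded_clinear A"
  shows "bounded_clinear (map_prod A A)"
proof -
  have "bounded_linear (\<lambda>p. (A (fst p), A (snd p)))"
    using bounded_clinear_bounded_linear[OF assms]
    by (intro bounded_linear_Pair bounded_linear_compose[OF _ bounded_linear_fst]
        bounded_linear_compose[OF _ bounded_linear_snd])
  then show ?thesis
    using assms by (simp add: bounded_clinear_def map_prod_def case_prod_unfold scaleC_prod_def)
qed

text \<open>Preserving the two axes makes an operator block diagonal, preserving the diagonal makes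
  its two blocks equal, and preserving the graphs makes the common block intertwine the
  operators whose graphs they are. Source and target may be different systems, so the
  endomorphisms and the isomorphisms are both covered.\<close>

lemma morphism_iff_intertwiner:
  fixes R :: "'a::chilbert_space \<times> 'a \<Rightarrow> 'b::chilbert_space \<times> 'b"
  assumes "unitary U" "unitary V" "unitary U'" "unitary V'"
  shows "bounded_clinear R \<and> (\<forall>i<length (system_UV U V). R ` (system_UV U V ! i) \<subseteq> system_UV U' V' ! i)
    \<longleftrightarrow> (\<exists>A. intertwiner U V U' V' A \<and> R = map_prod A A)" (is "?L \<longleftrightarrow> ?R")
proof
  assume ?L
  then have R: "bounded_clinear R"
    and maps: "\<forall>x. R (x, 0) \<in> range (\<lambda>x. (x, 0))" "\<forall>x. R (0, x) \<in> range (\<lambda>x. (0, x))"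
      "\<forall>x. R (x, x) \<in> range (\<lambda>x. (x, x))"
      "\<forall>x. R (x, cadjoint U x) \<in> range (\<lambda>x. (x, cadjoint U' x))"
      "\<forall>x. R (x, cadjoint V x) \<in> range (\<lambda>x. (x, cadjoint V' x))"
    unfolding system_UV_graphs[OF assms(1,2)] system_UV_graphs[OF assms(3,4)]
    by (simp_all add: All_less_Suc2 image_subset_iff)
  have graph: "snd p = g (fst p)" if "p \<in> range (\<lambda>x. (x, g x))" for p :: "'b \<times> 'b" and g
    using that by auto
  have vertical: "fst (R (0, x)) = 0" for x
    using maps(2)[rule_format, of x] by auto
  define A where "A x = fst (R (x, 0))" for x
  have split: "R (x, y) = R (x, 0) + R (0, y)" for x y
    using bounded_clinear_add[OF R, of "(x, 0)" "(0, y)"] by simp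
  have snd_R: "snd (R (0, x)) = A x" for x
    using graph[OF maps(3)[rule_format], of x] graph[OF maps(1)[rule_format], of x]
    unfolding split[of x x] by (simp add: vertical A_def)
  have R_eq: "R (x, y) = (A x, A y)" for x y
    using graph[OF maps(1)[rule_format], of x]
    unfolding split[of x y] by (simp add: prod_eq_iff vertical A_def snd_R)
  have "bounded_linear A"
    unfolding A_def
    by (intro bounded_linear_compose[OF bounded_linear_fst]
        bounded_linear_compose[OF bounded_clinear_bounded_linear[OF R]]
        bounded_linear_Pair bounded_linear_ident bounded_linear_zero)
  moreover have "A (c *\<^sub>C x) = c *\<^sub>C A x" for c x
    using bounded_clinear_scaleC_commute[OF R, of c "(x, 0)"] by (simp add: scaleC_prod_def A_def)
  ultimately have "bounded_clinear A" by (simp add: bounded_clinear_def)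
  moreover have "A (U x) = U' (A x)" for x
    using graph[OF maps(4)[rule_format]] intertwines_cadjoint_iff[OF assms(1,3), of A]
    by (simp add: R_eq)
  moreover have "A (V x) = V' (A x)" for x
    using graph[OF maps(5)[rule_format]] intertwines_cadjoint_iff[OF assms(2,4), of A]
    by (simp add: R_eq)
  moreover have "R = map_prod A A" using R_eq by (simp add: fun_eq_iff)
  ultimately show ?R unfolding intertwiner_def by blast
next
  assume ?R
  then obtain A where A: "intertwiner U V U' V' A" and R: "R = map_prod A A" by blast
  have lin: "bounded_clinear A" using A by (simp add: intertwiner_def)
  have "A (cadjoint U x) = cadjoint U' (A x)" "A (cadjoint V x) = cadjoint V' (A x)" for x
    using intertwines_cadjoint_iff[of _ _ A] assms A unfolding intertwiner_def by blast+
  then show ?L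
    unfolding system_UV_graphs[OF assms(1,2)] system_UV_graphs[OF assms(3,4)] R
    by (simp add: All_less_Suc2 image_subset_iff bounded_clinear_map_prod lin
        bounded_clinear_zero_right)
qed

lemma transitive_iff_commutant_scalar:
  fixes U V :: "'a::chilbert_space \<Rightarrow> 'a"
  assumes "unitary U" "unitary V"
  shows "transitive_system (system_UV U V) \<longleftrightarrow>
    (\<forall>A. intertwiner U V U V A \<longrightarrow> (\<exists>c. \<forall>x. A x = c *\<^sub>C x))"
proof -
  have End: "End_system (system_UV U V) = {map_prod A A | A. intertwiner U V U V A}"
    unfolding End_system_def morphism_iff_intertwiner[OF assms assms] by blast
  have sc: "map_prod A A = (\<lambda>p. c *\<^sub>C p) \<longleftrightarrow> (\<forall>x. A x = c *\<^sub>C x)" for c and A :: "'a \<Rightarrow> 'a"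
    by (auto simp: fun_eq_iff scaleC_prod_def)
  have "intertwiner U V U V (\<lambda>x. c *\<^sub>C x)" for c
    using assms by (simp add: intertwiner_def unitary_bounded_clinear bounded_clinear_scaleC_commute
        bounded_clinear_scaleC[OF bounded_clinear_id, unfolded id_def])
  then have "range (\<lambda>c (p::'a \<times> 'a). c *\<^sub>C p) \<subseteq> End_system (system_UV U V)"
    unfolding End image_subset_iff by (metis (mono_tags, lifting) mem_Collect_eq sc)
  then have "transitive_system (system_UV U V) \<longleftrightarrow>
      End_system (system_UV U V) \<subseteq> range (\<lambda>c (p::'a \<times> 'a). c *\<^sub>C p)"
    unfolding transitive_system_def by blast
  also have "\<dots> \<longleftrightarrow> (\<forall>A. intertwiner U V U V A \<longrightarrow> (\<exists>c. map_prod A A = (\<lambda>p. c *\<^sub>C p)))"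
    unfolding End by blast
  finally show ?thesis unfolding sc .
qed

lemma isomorphic_iff_bij_intertwiner:
  fixes U V :: "'a::chilbert_space \<Rightarrow> 'a" and U' V' :: "'b::chilbert_space \<Rightarrow> 'b"
  assumes "unitary U" "unitary V" "unitary U'" "unitary V'"
  shows "isomorphic_systems (system_UV U V) (system_UV U' V') \<longleftrightarrow>
    (\<exists>A. intertwiner U V U' V' A \<and> bij A)"
proof
  assume "isomorphic_systems (system_UV U V) (system_UV U' V')"
  then obtain R where R: "bounded_clinear R" "bij R"
    "\<forall>i<length (system_UV U V). R ` (system_UV U V ! i) = system_UV U' V' ! i"
    unfolding isomorphic_systems_def by blast
  then obtain A where A: "intertwiner U V U' V' A" and RA: "R = map_prod A A"
    using morphism_iff_intertwiner[OF assms, of R] by auto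
  have "inj A"
  proof (rule injI)
    fix x y assume "A x = A y"
    then have "R (x, x) = R (y, y)" by (simp add: RA)
    then show "x = y" using bij_is_inj[OF R(2)] by (auto dest: injD)
  qed
  moreover have "surj A"
  proof (rule surjI)
    fix y
    have "R (inv R (y, y)) = (y, y)" using R(2) by (simp add: bij_is_surj surj_f_inv_f)
    then show "A (fst (inv R (y, y))) = y" by (simp add: RA prod_eq_iff)
  qed
  ultimately show "\<exists>A. intertwiner U V U' V' A \<and> bij A" using A by (auto simp: bij_def)
next
  assume "\<exists>A. intertwiner U V U' V' A \<and> bij A"
  then obtain A where A: "intertwiner U V U' V' A" and bij: "bij A" by blast
  have lin: "bounded_clinear A" using A by (simp add: intertwiner_def)
  have comm: "A (cadjoint U x) = cadjoint U' (A x)" "A (cadjoint V x) = cadjoint V' (A x)" for x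
    using intertwines_cadjoint_iff[of _ _ A] assms A unfolding intertwiner_def by blast+
  have img: "map_prod A A ` range (\<lambda>x. (g x, h x)) = range (\<lambda>y. (g' y, h' y))"
    if "\<And>x. A (g x) = g' (A x)" "\<And>x. A (h x) = h' (A x)" for g h g' h'
  proof -
    have "map_prod A A ` range (\<lambda>x. (g x, h x)) = (\<lambda>y. (g' y, h' y)) ` range A"
      unfolding image_image by (simp add: that)
    then show ?thesis using bij by (simp add: bij_is_surj)
  qed
  have "\<forall>i<length (system_UV U V). map_prod A A ` (system_UV U V ! i) = system_UV U' V' ! i"
    unfolding system_UV_graphs[OF assms(1,2)] system_UV_graphs[OF assms(3,4)]
    by (simp add: All_less_Suc2) (intro conjI img comm refl bounded_clinear_zero_right lin)
  moreover have "bij (map_prod A A)"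
    using bij by (auto simp: bij_def prod.inj_map map_prod_surj)
  ultimately show "isomorphic_systems (system_UV U V) (system_UV U' V')"
    unfolding isomorphic_systems_def using bounded_clinear_map_prod[OF lin]
    by (auto simp: system_UV_def)
qed

text \<open>Polar decomposition: the unitary part of \<open>A\<close> intertwines as well, because \<open>B = |A|\<close>
  commutes with \<open>U\<close> and \<open>V\<close>. The operator \<open>Y = B A\<^sup>-\<^sup>1\<close>, the adjoint of the unitary part, is easier to
  handle than \<open>A B\<^sup>-\<^sup>1\<close>: it is defined everywhere, and the identity \<open>\<parallel>B x\<parallel> = \<parallel>A x\<parallel>\<close> makes it isometric,
  so that no bound for an inverse operator has to be found.\<close>

lemma bij_intertwiner_imp_unitary_intertwiner:
  fixes A :: "'a::chilbert_space \<Rightarrow> 'b::chilbert_space"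
  assumes UV: "unitary U" "unitary V" "unitary U'" "unitary V'"
    and A: "intertwiner U V U' V' A" and bij: "bij A"
    and contr: "\<And>x. norm (A x) \<le> norm x"
  obtains W where "unitary W" "intertwiner U V U' V' W"
proof -
  have lin: "bounded_clinear A" and com: "A (U x) = U' (A x)" "A (V x) = V' (A x)" for x
    using A by (auto simp: intertwiner_def)
  obtain B where B: "bounded_clinear B" and BB: "\<And>x. B (B x) = cadjoint A (A x)"
    and symB: "\<And>x y. inner (B x) y = inner x (B y)" and "\<And>x. norm (x - B x) \<le> norm x"
    and comB: "\<And>C x. bounded_clinear C \<Longrightarrow> (\<And>x. C (cadjoint A (A x)) = cadjoint A (A (C x)))
      \<Longrightarrow> C (B x) = B (C x)"
    by (fact contraction_modulus[OF lin contr])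
  have BU: "B (U x) = U (B x)" for x
    by (rule comB[symmetric])
      (simp_all add: unitary_bounded_clinear UV com cadjoint_intertwines[OF lin UV(1,3) com(1)])
  have BV: "B (V x) = V (B x)" for x
    by (rule comB[symmetric])
      (simp_all add: unitary_bounded_clinear UV com cadjoint_intertwines[OF lin UV(2,4) com(2)])
  define Y where "Y y = B (inv A y)" for y
  have YA: "Y (A x) = B x" for x
    using bij by (simp add: Y_def bij_is_inj)
  have surj: "\<exists>x. y = A x" for y
    using bij by (metis bij_pointE)
  have iso: "inner (Y u) (Y v) = inner u v" for u v
  proof -
    obtain x z where "u = A x" "v = A z" using surj by blast
    then show ?thesis by (simp add: YA symB BB inner_cadjoint_right[OF lin])
  qed
  have Yadd: "Y (u + v) = Y u + Y v" for u v
  proof -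
    obtain x z where "u = A x" "v = A z" using surj by blast
    then show ?thesis
      by (simp add: YA bounded_clinear_add[OF B] bounded_clinear_add[OF lin, symmetric])
  qed
  have Yscale: "Y (c *\<^sub>C u) = c *\<^sub>C Y u" for c u
  proof -
    obtain x where "u = A x" using surj by blast
    then show ?thesis
      by (simp add: YA bounded_clinear_scaleC_commute[OF B]
          bounded_clinear_scaleC_commute[OF lin, symmetric])
  qed
  have "norm (Y u) = norm u" for u by (simp add: norm_eq_sqrt_inner iso)
  then have "bounded_linear Y"
    by (intro bounded_linear_intro[where K=1]) (simp_all add: Yadd Yscale scaleR_scaleC)
  then have Y: "bounded_clinear Y" by (simp add: bounded_clinear_def Yscale)
  have left: "cadjoint Y (Y u) = u" for u
  proof -
    have "inner v (cadjoint Y (Y u)) = inner v u" for v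
      by (simp add: inner_cadjoint_right[OF Y] iso)
    then show ?thesis using vector_eq_ldot by blast
  qed
  have right: "Y (cadjoint Y z) = z" for z
  proof -
    \<comment> \<open>\<open>w\<close> is orthogonal to the range of \<open>Y\<close>, which is the range of \<open>B\<close>; as \<open>B\<close> is symmetric, \<open>w\<close> lies in
      its kernel, and \<open>B\<close> has the same kernel as the injective operator \<open>A\<close>.\<close>
    define w where "w = z - Y (cadjoint Y z)"
    have "cadjoint Y w = 0"
      by (simp add: w_def bounded_clinear_diff[OF bounded_clinear_cadjoint[OF Y]] left)
    then have "inner w (Y (A x)) = 0" for x
      by (simp add: inner_cadjoint_left[OF Y, symmetric])
    then have "inner (B w) x = 0" for x
      by (simp add: YA symB)
    then have "B w = 0" by (metis inner_eq_zero_iff)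
    then have "cadjoint A (A w) = 0"
      by (simp add: BB[symmetric] bounded_clinear_zero_right[OF B])
    then have "inner (A w) (A w) = 0"
      by (simp add: inner_cadjoint_right[OF lin, symmetric])
    then have "A w = A 0" by (simp add: bounded_clinear_zero_right[OF lin])
    then have "w = 0" using bij by (simp add: bij_is_inj inj_eq)
    then show ?thesis by (simp add: w_def)
  qed
  have "unitary Y" using Y by (simp add: unitary_def fun_eq_iff left right)
  moreover have "intertwiner U' V' U V Y"
  proof -
    have "Y (U' u) = U (Y u) \<and> Y (V' u) = V (Y u)" for u
    proof -
      obtain x where "u = A x" using surj by blast
      then show ?thesis by (simp add: com[symmetric] YA BU BV)
    qed
    then show ?thesis using Y by (simp add: intertwiner_def)
  qed
  ultimately show thesis
    using that[of "cadjoint Y"] unitary_cadjoint intertwiner_cadjoint UV by blast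
qed

lemma bij_intertwiner_iff_unitarily_equivalent:
  fixes U V :: "'a::chilbert_space \<Rightarrow> 'a" and U' V' :: "'b::chilbert_space \<Rightarrow> 'b"
  assumes UV: "unitary U" "unitary V" "unitary U'" "unitary V'"
  shows "(\<exists>A. intertwiner U V U' V' A \<and> bij A) \<longleftrightarrow> unitarily_equivalent_pairs U V U' V'"
proof
  assume "unitarily_equivalent_pairs U V U' V'"
  then obtain W where "unitary W" "W \<circ> U = U' \<circ> W" "W \<circ> V = V' \<circ> W"
    unfolding unitarily_equivalent_pairs_def by blast
  then have "intertwiner U V U' V' W \<and> bij W"
    by (auto simp: intertwiner_def unitary_bounded_clinear unitary_bij fun_eq_iff)
  then show "\<exists>A. intertwiner U V U' V' A \<and> bij A" by blast
next
  assume "\<exists>A. intertwiner U V U' V' A \<and> bij A"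
  then obtain A where A: "intertwiner U V U' V' A" and bij: "bij A" by blast
  then have lin: "bounded_clinear A" by (simp add: intertwiner_def)
  obtain r :: real where r: "r > 0" "\<And>x. norm (complex_of_real r *\<^sub>C A x) \<le> norm x"
    by (rule bounded_clinear_contraction_multiple[OF lin]) blast
  let ?rA = "\<lambda>x. complex_of_real r *\<^sub>C A x"
  have "intertwiner U V U' V' ?rA"
    using A UV by (simp add: intertwiner_def bounded_clinear_scaleC
        bounded_clinear_scaleC_commute unitary_bounded_clinear)
  moreover have "bij ?rA"
  proof (rule o_bij)
    show "(\<lambda>y. inv A (complex_of_real (1 / r) *\<^sub>C y)) \<circ> ?rA = id"
      using r(1) bij by (simp add: fun_eq_iff scaleC_scaleC scaleC_one bij_is_inj)
    show "?rA \<circ> (\<lambda>y. inv A (complex_of_real (1 / r) *\<^sub>C y)) = id"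
      using r(1) bij by (simp add: fun_eq_iff scaleC_scaleC scaleC_one bij_is_surj surj_f_inv_f)
  qed
  ultimately obtain W where "unitary W" "intertwiner U V U' V' W"
    using bij_intertwiner_imp_unitary_intertwiner[OF UV _ _ r(2)] by blast
  then show "unitarily_equivalent_pairs U V U' V'"
    unfolding unitarily_equivalent_pairs_def intertwiner_def by (auto simp: fun_eq_iff)
qed

theorem theorem1:
  fixes U V :: "'a::chilbert_space \<Rightarrow> 'a"
    and U' V' :: "'b::chilbert_space \<Rightarrow> 'b"
  assumes "(UNIV :: 'a set) \<noteq> {0}" and "(UNIV :: 'b set) \<noteq> {0}"
    and "unitary U" and "unitary V" and "unitary U'" and "unitary V'"
  shows "(transitive_system (system_UV U V) \<longleftrightarrow> irreducible_pair U V) \<and>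
    (isomorphic_systems (system_UV U V) (system_UV U' V') \<longleftrightarrow>
       unitarily_equivalent_pairs U V U' V')"
  by (simp add: assms transitive_iff_commutant_scalar irreducible_iff_commutant_scalar
      isomorphic_iff_bij_intertwiner bij_intertwiner_iff_unitarily_equivalent)

end
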